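(* Let $0<p<1$, let $\{G_n : n\ge 1\}$ be the Superstar model with parameter $p$, and for $n\ge2$ let $$\Upsilon_n=\max_{1\le i\le n-1}\deg(v_i,G_n)$$ be the largest degree among the nonsuperstar vertices. Let $\gamma=(1-p)/(2-p)$. There exists a random variable $\Delta^*$ with $\mathbb P(0<\Delta^*<\infty)=1$ such that $$\frac{1}{n^{\gamma}}\Upsilon_n\longrightarrow\Delta^*\quad\text{in probability as }n\to\infty .$$
   Context: Superstar model with parameter $p\in(0,1)$: a growing sequence of random trees $G_1,G_2,\dots$ constructed sequentially on one probability space. $G_1$ is the single vertex $v_0$ (the superstar). $G_2$ consists of $v_0$, a vertex $v_1$ and the edge between them. For $n\ge 2$, given $G_n$ (with vertex set $\{v_0,\dots,v_{n-1}\}$), $G_{n+1}$ is obtained by adding a new vertex $v_n$ and one edge: with probability $p$ the vertex $v_n$ is joined to $v_0$; with probability $1-p$ it is joined to one of the nonsuperstars $v_1,\dots,v_{n-1}$, where $v_i$ is chosen with probability proportional to its degree in $G_n$. $\deg(v,G)$ denotes the degree of vertex $v$ in the graph $G$. *)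

theory Defs
  imports "HOL-Probability.Probability"
begin

text \<open>
  A finite simple graph is a pair of its vertex set and its set of edges, an edge being the
  two-element set of its endpoints. The natural number \<open>i\<close> stands for the vertex \<open>v\<^sub>i\<close>;
  in particular \<open>0\<close> is the superstar \<open>v\<^sub>0\<close>.
\<close>

type_synonym graph = "nat set \<times> nat set set"

definition verts :: "graph \<Rightarrow> nat set" where
  "verts g = fst g"

definition edges :: "graph \<Rightarrow> nat set set" where
  "edges g = snd g"

definition degree :: "nat \<Rightarrow> graph \<Rightarrow> nat" where
  "degree v g = card {e \<in> edges g. v \<in> e}"

definition attach :: "graph \<Rightarrow> nat \<Rightarrow> nat \<Rightarrow> graph" where
  "attach g v u = (insert v (verts g), insert {u, v} (edges g))"

text \<open>
  The probability that \<open>v\<^sub>n\<close> is joined to \<open>v\<^sub>i\<close> (\<open>i < n\<close>), given that \<open>G\<^sub>n = g\<close>. The normalising sum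
  does not include the superstar.
\<close>

definition attach_prob :: "real \<Rightarrow> nat \<Rightarrow> graph \<Rightarrow> nat \<Rightarrow> real" where
  "attach_prob p n g i =
     (if i = 0 then p
      else (1 - p) * (real (degree i g) / (\<Sum>j = 1..n - 1. real (degree j g))))"

text \<open>
  The process is indexed by \<open>n \<ge> 1\<close>; \<open>G 0\<close> is unconstrained. The numbers \<open>attach_prob p n g i\<close>
  for \<open>i < n\<close> add up to \<open>1\<close> when \<open>G\<^sub>n = g\<close> has positive probability, so \<open>transition\<close> determines the conditional law of \<open>G\<^sub>n\<^sub>+\<^sub>1\<close> given
  \<open>G\<^sub>n\<close>. Since the labelled tree \<open>G\<^sub>n\<close> almost surely determines \<open>G\<^sub>1, \<dots>, G\<^sub>n\<^sub>-\<^sub>1\<close>, conditioning on \<open>G\<^sub>n\<close>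
  is the same as conditioning on the whole past.
\<close>

locale superstar_model = prob_space M
  for M :: "'a measure" and p :: real and G :: "nat \<Rightarrow> 'a \<Rightarrow> graph" +
  assumes random_graph: "n \<ge> 1 \<Longrightarrow> random_variable (count_space UNIV) (G n)"
    and initial_1: "AE \<omega> in M. G 1 \<omega> = ({0}, {})"
    and initial_2: "AE \<omega> in M. G 2 \<omega> = ({0, 1}, {{0, 1}})"
    and transition:
      "n \<ge> 2 \<Longrightarrow> i < n \<Longrightarrow> prob {\<omega> \<in> space M. G n \<omega> = g} > 0 \<Longrightarrow>
         \<P>(\<omega> in M. G (Suc n) \<omega> = attach g n i \<bar> G n \<omega> = g) = attach_prob p n g i"

definition max_nonsuperstar_degree :: "nat \<Rightarrow> graph \<Rightarrow> nat" where
  "max_nonsuperstar_degree n g = Max ((\<lambda>i. degree i g) ` {1..n - 1})"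

definition tendsto_in_probability ::
    "'a measure \<Rightarrow> (nat \<Rightarrow> 'a \<Rightarrow> real) \<Rightarrow> ('a \<Rightarrow> real) \<Rightarrow> bool" where
  "tendsto_in_probability M X Y \<longleftrightarrow>
     (\<forall>\<epsilon>>0. (\<lambda>n. measure M {\<omega> \<in> space M. \<bar>X n \<omega> - Y \<omega>\<bar> > \<epsilon>}) \<longlonglongrightarrow> 0)"

end

(* Let D_i(n) be the degree of v_i in G_n, S_n the sum of the D_i(n), 1 <= i < n, and
   Pi_n = prod_{2 <= j < n} (1 + (1 - p) / S_j). Given G_n, a nonsuperstar degree grows by the factor
   1 + (1 - p) / S_n in expectation and Pi_n depends only on the past, so every D_i(n) / Pi_n is a
   martingale and Y_n = max_i D_i(n) / Pi_n is a nonnegative submartingale. Rising factorials of high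
   order k of the degrees, divided by the products Pi^(k)_n with factors 1 + k (1 - p) / S_j, are
   martingales as well; Pi^(k) grows so fast that summing over all vertices gives a bound on E Y_n^2
   that is uniform in n. For a nonnegative submartingale E (Y_m - Y_n)^2 <= E Y_m^2 - E Y_n^2, so Y_n is
   Cauchy in L^2 and converges in probability. The limit is positive because the rising factorial of
   order -1/2 of D_1 gives a martingale that dominates (D_1(n) / Pi_n)^(-1/2) up to a constant.
   Finally S_n - (2 - p) n has variance O(n), hence ln Pi_n - gamma ln n converges almost surely. *)
theory Submission
  imports Defs
begin

section \<open>Convergence in probability\<close>

text \<open>New vertices keep arriving, so the maximum runs over a growing set and no single degree
  martingale controls it. A newborn adds k! / Pi^(k) to the sum of the martingales of order k, and k
  is chosen with k (1 - p) >= 4: since S_j < 2 j on every path, Pi^(k) is then at least quadratic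
  and the newborn terms are summable. Dividing by the random Pi_n instead of n^gamma makes the
  martingale identities exact. The passage to n^gamma concerns S_n alone, whose increment is 1 with
  probability p and 2 with probability 1 - p whatever the tree; its mean 2 - p is the denominator of
  gamma. For positivity one vertex is enough, because the maximum dominates the degree of v_1. Any
  order above -1 keeps the factors positive, as degrees and S_j are at least 1; the order -1/2
  leaves only squares to estimate. No filtration is introduced: all quantities are functions of the
  labelled tree, and the operator \<open>step\<close> plays the role of conditional
  expectation.\<close>

lemma convergent_if_summable_increments:
  fixes f :: "nat \<Rightarrow> 'a::real_normed_vector"
  assumes "summable (\<lambda>n. f (Suc n) - f n)"
  shows "convergent f"
proof -
  have "convergent (\<lambda>n. f n - f 0)"
    using assms by (simp add: summable_iff_convergent sum_lessThan_telescope)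
  then have "convergent (\<lambda>n. (f n - f 0) + f 0)"
    by (intro convergent_add convergent_const)
  then show ?thesis by simp
qed

lemma tendsto_in_probabilityD:
  "tendsto_in_probability M X Y \<Longrightarrow> \<epsilon> > 0 \<Longrightarrow>
    (\<lambda>n. measure M {\<omega> \<in> space M. \<bar>X n \<omega> - Y \<omega>\<bar> > \<epsilon>}) \<longlonglongrightarrow> 0"
  by (simp add: tendsto_in_probability_def)

lemma tendsto_in_probability_offset:
  assumes "tendsto_in_probability M (\<lambda>n. X (n + k)) Y"
  shows "tendsto_in_probability M X Y"
  unfolding tendsto_in_probability_def
proof (intro allI impI)
  fix \<epsilon> :: real assume "\<epsilon> > 0"
  show "(\<lambda>n. measure M {\<omega> \<in> space M. \<bar>X n \<omega> - Y \<omega>\<bar> > \<epsilon>}) \<longlonglongrightarrow> 0"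
    using tendsto_in_probabilityD[OF assms \<open>\<epsilon> > 0\<close>] by (rule LIMSEQ_offset)
qed

lemma tendsto_in_probability_AE_cong:
  assumes [measurable]: "\<And>n. X n \<in> borel_measurable M" "\<And>n. X' n \<in> borel_measurable M" "Y \<in> borel_measurable M"
    and eq: "\<And>n. AE \<omega> in M. X n \<omega> = X' n \<omega>" and X: "tendsto_in_probability M X Y"
  shows "tendsto_in_probability M X' Y"
  unfolding tendsto_in_probability_def
proof (intro allI impI)
  fix \<epsilon> :: real assume "\<epsilon> > 0"
  have "measure M {\<omega> \<in> space M. \<bar>X n \<omega> - Y \<omega>\<bar> > \<epsilon>} = measure M {\<omega> \<in> space M. \<bar>X' n \<omega> - Y \<omega>\<bar> > \<epsilon>}" for n
  proof (rule measure_eq_AE)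
    show "AE \<omega> in M. (\<omega> \<in> {\<omega> \<in> space M. \<bar>X n \<omega> - Y \<omega>\<bar> > \<epsilon>}) = (\<omega> \<in> {\<omega> \<in> space M. \<bar>X' n \<omega> - Y \<omega>\<bar> > \<epsilon>})"
      using eq[of n] by eventually_elim simp
  qed measurable
  then show "(\<lambda>n. measure M {\<omega> \<in> space M. \<bar>X' n \<omega> - Y \<omega>\<bar> > \<epsilon>}) \<longlonglongrightarrow> 0"
    using tendsto_in_probabilityD[OF X \<open>\<epsilon> > 0\<close>] by simp
qed

context prob_space
begin

lemma tendsto_in_probability_AE:
  assumes [measurable]: "\<And>n. X n \<in> borel_measurable M" "Y \<in> borel_measurable M"
    and lim: "AE x in M. (\<lambda>n. X n x) \<longlonglongrightarrow> (Y x :: real)"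
  shows "tendsto_in_probability M X Y"
  unfolding tendsto_in_probability_def
proof (intro allI impI)
  fix e :: real assume e: "0 < e"
  let ?A = "\<lambda>n. {x \<in> space M. \<bar>X n x - Y x\<bar> > e}"
  have "(\<lambda>n. \<integral>x. indicator (?A n) x \<partial>M) \<longlonglongrightarrow> (\<integral>x. 0 \<partial>M :: real)"
  proof (rule integral_dominated_convergence[where w = "\<lambda>_. 1"])
    show "AE x in M. (\<lambda>n. indicator (?A n) x :: real) \<longlonglongrightarrow> 0"
      using lim
    proof eventually_elim
      case (elim x)
      have "\<forall>\<^sub>F n in sequentially. dist (X n x) (Y x) < e"
        using elim e by (rule tendstoD)
      then have "\<forall>\<^sub>F n in sequentially. (indicator (?A n) x :: real) = 0"
        by eventually_elim (auto simp: dist_real_def)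
      then show ?case by (rule tendsto_eventually)
    qed
  qed (auto simp: indicator_def)
  then show "(\<lambda>n. prob (?A n)) \<longlonglongrightarrow> 0" by simp
qed

lemma tendsto_in_probability_mult:
  assumes [measurable]: "\<And>n. X n \<in> borel_measurable M" "\<And>n. X' n \<in> borel_measurable M"
      "Y \<in> borel_measurable M" "Y' \<in> borel_measurable M"
    and X: "tendsto_in_probability M X Y" "tendsto_in_probability M X' Y'"
  shows "tendsto_in_probability M (\<lambda>n x. X n x * X' n x) (\<lambda>x. Y x * Y' x)"
  unfolding tendsto_in_probability_def
proof (intro allI impI)
  \<comment> \<open>Tightness of a single real random variable, from the pointwise limit Z / (n + 1)
    -> 0. Applied to both limits, it bounds the factors multiplying the errors.\<close>
  have tight: "\<exists>K\<ge>1. prob {x \<in> space M. \<bar>Z x\<bar> > K} < e"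
    if [measurable]: "Z \<in> borel_measurable M" and "e > 0" for Z :: "'a \<Rightarrow> real" and e
  proof -
    have "tendsto_in_probability M (\<lambda>n x. Z x / real (Suc n)) (\<lambda>_. 0)"
    proof (rule tendsto_in_probability_AE, simp, simp, intro AE_I2)
      fix x
      show "(\<lambda>n. Z x / real (Suc n)) \<longlonglongrightarrow> 0"
        using LIMSEQ_Suc[OF lim_const_over_n[of "Z x"]] .
    qed
    then have "(\<lambda>n. prob {x \<in> space M. \<bar>Z x / real (Suc n) - 0\<bar> > 1}) \<longlonglongrightarrow> 0"
      by (rule tendsto_in_probabilityD) simp
    then have "\<forall>\<^sub>F n in sequentially. prob {x \<in> space M. \<bar>Z x / real (Suc n) - 0\<bar> > 1} < e"
      using \<open>e > 0\<close> by (rule order_tendstoD)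
    then obtain n where "prob {x \<in> space M. \<bar>Z x / real (Suc n) - 0\<bar> > 1} < e"
      by (auto simp: eventually_sequentially)
    moreover have "{x \<in> space M. \<bar>Z x / real (Suc n) - 0\<bar> > 1} = {x \<in> space M. \<bar>Z x\<bar> > real (Suc n)}"
      by (simp add: less_divide_eq)
    ultimately show ?thesis by (intro exI[of _ "real (Suc n)"]) simp
  qed
  fix \<epsilon> :: real assume "\<epsilon> > 0"
  show "(\<lambda>n. prob {x \<in> space M. \<bar>X n x * X' n x - Y x * Y' x\<bar> > \<epsilon>}) \<longlonglongrightarrow> 0"
  proof (rule LIMSEQ_I)
    fix e :: real assume "e > 0"
    obtain K where K: "K \<ge> 1" "prob {x \<in> space M. \<bar>Y x\<bar> > K} < e / 4"
      using tight[of Y "e / 4"] \<open>e > 0\<close> by auto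
    obtain K' where K': "K' \<ge> 1" "prob {x \<in> space M. \<bar>Y' x\<bar> > K'} < e / 4"
      using tight[of Y' "e / 4"] \<open>e > 0\<close> by auto
    \<comment> \<open>Off the four exceptional events the error is at most d * d + d * K' + K * d.
      The cap \<open>d \<le> 1\<close> absorbs the quadratic term, leaving d * (1 + K + K').\<close>
    define d where "d = min 1 (\<epsilon> / (1 + K + K'))"
    have d: "0 < d" "d \<le> 1" "d * (1 + K + K') \<le> \<epsilon>"
      using K(1) K'(1) \<open>\<epsilon> > 0\<close> by (auto simp: d_def pos_le_divide_eq[symmetric])
    have "\<forall>\<^sub>F n in sequentially. prob {x \<in> space M. \<bar>X n x - Y x\<bar> > d} < e / 4"
      "\<forall>\<^sub>F n in sequentially. prob {x \<in> space M. \<bar>X' n x - Y' x\<bar> > d} < e / 4"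
      using X[THEN tendsto_in_probabilityD, OF d(1), THEN order_tendstoD(2), of "e / 4"] \<open>e > 0\<close>
      by simp_all
    then have "\<forall>\<^sub>F n in sequentially. prob {x \<in> space M. \<bar>X n x * X' n x - Y x * Y' x\<bar> > \<epsilon>} < e"
    proof eventually_elim
      case (elim n)
      let ?A = "{x \<in> space M. \<bar>X n x - Y x\<bar> > d}" let ?B = "{x \<in> space M. \<bar>X' n x - Y' x\<bar> > d}"
      let ?C = "{x \<in> space M. \<bar>Y x\<bar> > K}" let ?D = "{x \<in> space M. \<bar>Y' x\<bar> > K'}"
      have "{x \<in> space M. \<bar>X n x * X' n x - Y x * Y' x\<bar> > \<epsilon>} \<subseteq> (?A \<union> ?B) \<union> (?C \<union> ?D)"
      proof (rule subsetI, rule ccontr)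
        fix x assume x: "x \<in> {x \<in> space M. \<bar>X n x * X' n x - Y x * Y' x\<bar> > \<epsilon>}"
          "x \<notin> (?A \<union> ?B) \<union> (?C \<union> ?D)"
        then have *: "\<bar>X n x - Y x\<bar> \<le> d" "\<bar>X' n x - Y' x\<bar> \<le> d" "\<bar>Y x\<bar> \<le> K" "\<bar>Y' x\<bar> \<le> K'" by auto
        have "X n x * X' n x - Y x * Y' x = (X n x - Y x) * (X' n x - Y' x) +
            ((X n x - Y x) * Y' x + Y x * (X' n x - Y' x))" by algebra
        also have "\<bar>\<dots>\<bar> \<le> \<bar>X n x - Y x\<bar> * \<bar>X' n x - Y' x\<bar> + (\<bar>X n x - Y x\<bar> * \<bar>Y' x\<bar> + \<bar>Y x\<bar> * \<bar>X' n x - Y' x\<bar>)"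
          unfolding abs_mult[symmetric] by linarith
        also have "\<dots> \<le> d * 1 + (d * K' + K * d)"
          using * d K K' by (intro add_mono mult_mono) auto
        also have "\<dots> \<le> \<epsilon>" using d(3) by (simp add: algebra_simps)
        finally show False using x(1) by simp
      qed
      then have "prob {x \<in> space M. \<bar>X n x * X' n x - Y x * Y' x\<bar> > \<epsilon>} \<le> prob ((?A \<union> ?B) \<union> (?C \<union> ?D))"
        by (intro finite_measure_mono) auto
      also have "\<dots> \<le> prob (?A \<union> ?B) + prob (?C \<union> ?D)"
        by (intro measure_Un_le) auto
      also have "\<dots> \<le> (prob ?A + prob ?B) + (prob ?C + prob ?D)"
        by (intro add_mono measure_Un_le) auto
      finally show ?case using elim K K' by linarith
    qed
    then show "\<exists>no. \<forall>n\<ge>no. norm (prob {x \<in> space M. \<bar>X n x * X' n x - Y x * Y' x\<bar> > \<epsilon>} - 0) < e"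
      by (simp add: eventually_sequentially)
  qed
qed

text \<open>Completeness of convergence in probability: a fast subsequence converges almost surely
  by Borel-Cantelli and the Cauchy property carries the rest along. One \<open>e\<close> may serve
  both as threshold and as probability bound, because shrinking it strengthens both
  requirements.\<close>

lemma Cauchy_in_probability:
  fixes X :: "nat \<Rightarrow> 'a \<Rightarrow> real"
  assumes [measurable]: "\<And>n. X n \<in> borel_measurable M"
    and Cauchy: "\<And>e. e > 0 \<Longrightarrow> \<exists>N. \<forall>m\<ge>N. \<forall>n\<ge>N. prob {x \<in> space M. \<bar>X m x - X n x\<bar> > e} \<le> e"
  obtains Y where "Y \<in> borel_measurable M" "tendsto_in_probability M X Y"
proof -
  have "\<exists>N. \<forall>m\<ge>N. \<forall>n\<ge>N. prob {x \<in> space M. \<bar>X m x - X n x\<bar> > (1 / 2) ^ k} \<le> (1 / 2) ^ k" for k :: nat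
    by (rule Cauchy) simp
  then obtain N where N: "\<And>k m n. m \<ge> N k \<Longrightarrow> n \<ge> N k \<Longrightarrow>
      prob {x \<in> space M. \<bar>X m x - X n x\<bar> > (1 / 2) ^ k} \<le> (1 / 2) ^ k"
    by metis
  \<comment> \<open>The partial sum makes both \<open>r k\<close> and \<open>r (Suc k)\<close>
    exceed \<open>N k\<close>; the summand \<open>k\<close> makes the indices unbounded.\<close>
  define r where "r k = k + (\<Sum>j\<le>k. N j)" for k
  have r: "k \<le> r k" "N k \<le> r k" "N k \<le> r (Suc k)" for k
    using member_le_sum[of k "{..k}" N] by (auto simp: r_def)
  have "AE x in M. \<forall>\<^sub>F k in sequentially. x \<in> space M - {x \<in> space M. \<bar>X (r (Suc k)) x - X (r k) x\<bar> > (1 / 2) ^ k}"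
  proof (rule borel_cantelli_AE1)
    show "summable (\<lambda>k. prob {x \<in> space M. \<bar>X (r (Suc k)) x - X (r k) x\<bar> > (1 / 2) ^ k})"
      by (rule summable_comparison_test'[where g = "\<lambda>k. (1 / 2) ^ k" and N = 0]) (use N r in auto)
  qed (auto simp: emeasure_eq_measure)
  then have conv: "AE x in M. convergent (\<lambda>k. X (r k) x)"
  proof eventually_elim
    case (elim x)
    then have "\<forall>\<^sub>F k in sequentially. norm (X (r (Suc k)) x - X (r k) x) \<le> (1 / 2) ^ k"
      by eventually_elim auto
    then have "summable (\<lambda>k. X (r (Suc k)) x - X (r k) x)"
      by (rule summable_comparison_test_ev) (simp add: summable_geometric)
    then show ?case
      by (rule convergent_if_summable_increments[where f = "\<lambda>k. X (r k) x"])
  qed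
  define Y where "Y x = lim (\<lambda>k. X (r k) x)" for x
  have [measurable]: "Y \<in> borel_measurable M" unfolding Y_def by measurable
  have sub: "tendsto_in_probability M (\<lambda>k. X (r k)) Y"
    by (rule tendsto_in_probability_AE) (use conv in \<open>auto simp: convergent_LIMSEQ_iff Y_def\<close>)
  have "tendsto_in_probability M X Y"
    unfolding tendsto_in_probability_def
  proof (intro allI impI LIMSEQ_I)
    fix \<epsilon> e :: real assume "\<epsilon> > 0" "e > 0"
    define d where "d = min (\<epsilon> / 2) (e / 2)"
    have d: "d > 0" "d \<le> \<epsilon> / 2" "d \<le> e / 2" using \<open>\<epsilon> > 0\<close> \<open>e > 0\<close> by (auto simp: d_def)
    obtain n0 where n0: "\<And>m n. m \<ge> n0 \<Longrightarrow> n \<ge> n0 \<Longrightarrow> prob {x \<in> space M. \<bar>X m x - X n x\<bar> > d} \<le> d"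
      using Cauchy[OF d(1)] by blast
    have "(\<lambda>k. prob {x \<in> space M. \<bar>X (r k) x - Y x\<bar> > \<epsilon> / 2}) \<longlonglongrightarrow> 0"
      using \<open>\<epsilon> > 0\<close> by (intro tendsto_in_probabilityD[OF sub]) simp
    then have "\<forall>\<^sub>F k in sequentially. prob {x \<in> space M. \<bar>X (r k) x - Y x\<bar> > \<epsilon> / 2} < e / 2"
      using \<open>e > 0\<close> by (intro order_tendstoD(2)) auto
    then have "\<forall>\<^sub>F k in sequentially. prob {x \<in> space M. \<bar>X (r k) x - Y x\<bar> > \<epsilon> / 2} < e / 2 \<and> k \<ge> n0"
      by (intro eventually_conj eventually_ge_at_top)
    then obtain k where k: "prob {x \<in> space M. \<bar>X (r k) x - Y x\<bar> > \<epsilon> / 2} < e / 2" "k \<ge> n0"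
      by (auto simp: eventually_sequentially)
    have "prob {x \<in> space M. \<bar>X n x - Y x\<bar> > \<epsilon>} < e" if "n \<ge> n0" for n
    proof -
      have "prob {x \<in> space M. \<bar>X n x - Y x\<bar> > \<epsilon>} \<le>
        prob ({x \<in> space M. \<bar>X n x - X (r k) x\<bar> > d} \<union> {x \<in> space M. \<bar>X (r k) x - Y x\<bar> > \<epsilon> / 2})"
      proof (rule finite_measure_mono)
        have "d < \<bar>a - b\<bar>" if "\<epsilon> < \<bar>a - c\<bar>" "\<not> \<epsilon> / 2 < \<bar>b - c\<bar>" for a b c
          using that d(2) by linarith
        then show "{x \<in> space M. \<bar>X n x - Y x\<bar> > \<epsilon>} \<subseteq> {x \<in> space M. \<bar>X n x - X (r k) x\<bar> > d} \<union>
            {x \<in> space M. \<bar>X (r k) x - Y x\<bar> > \<epsilon> / 2}" by blast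
      qed measurable
      also have "\<dots> \<le> prob {x \<in> space M. \<bar>X n x - X (r k) x\<bar> > d} + prob {x \<in> space M. \<bar>X (r k) x - Y x\<bar> > \<epsilon> / 2}"
        by (intro measure_Un_le) auto
      also have "\<dots> < e" using n0[OF that, of "r k"] r(1)[of k] k d by auto
      finally show ?thesis .
    qed
    then show "\<exists>n0. \<forall>n\<ge>n0. norm (prob {x \<in> space M. \<bar>X n x - Y x\<bar> > \<epsilon>} - 0) < e" by auto
  qed
  then show thesis using that \<open>Y \<in> borel_measurable M\<close> by blast
qed

text \<open>Exchanging sum and integral for nonnegative terms shows that the random series has
  finite mean, hence is finite almost surely.\<close>

lemma AE_summable:
  fixes b :: "nat \<Rightarrow> 'a \<Rightarrow> real"
  assumes b: "\<And>n. integrable M (b n)" "\<And>n x. b n x \<ge> 0" and sum: "summable (\<lambda>n. expectation (b n))"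
  shows "AE x in M. summable (\<lambda>n. b n x)"
proof -
  have [measurable]: "b n \<in> borel_measurable M" for n using b(1) by (rule borel_measurable_integrable)
  have "(\<integral>\<^sup>+x. (\<Sum>n. ennreal (b n x)) \<partial>M) = (\<Sum>n. \<integral>\<^sup>+x. ennreal (b n x) \<partial>M)"
    by (rule nn_integral_suminf) simp
  also have "\<dots> = (\<Sum>n. ennreal (expectation (b n)))"
    by (intro suminf_cong nn_integral_eq_integral b AE_I2)
  also have "\<dots> = ennreal (\<Sum>n. expectation (b n))"
    by (intro suminf_ennreal2 sum integral_nonneg_AE AE_I2 b)
  finally have "(\<integral>\<^sup>+x. (\<Sum>n. ennreal (b n x)) \<partial>M) \<noteq> \<infinity>" by simp
  then have "AE x in M. (\<Sum>n. ennreal (b n x)) \<noteq> \<infinity>"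
    by (intro nn_integral_noteq_infinite) auto
  then show ?thesis
    by eventually_elim (auto intro!: summable_suminf_not_top b)
qed

end

section \<open>Degrees along an attachment sequence\<close>

text \<open>A finite set that carries the law of the tree, so that expectations become finite sums.
  The process starts at index 2; the values at 0 and 1 are fillers.\<close>

primrec reachable :: "nat \<Rightarrow> graph set" where
  "reachable 0 = {({0, 1}, {{0, 1}})}"
| "reachable (Suc n) = (if n < 2 then {({0, 1}, {{0, 1}})}
     else (\<lambda>(g, i). attach g n i) ` (reachable n \<times> {..<n}))"

text \<open>
  For \<open>g = G\<^sub>n\<close> and \<open>j \<le> n\<close> this is the degree of \<open>v\<close> in the earlier tree \<open>G\<^sub>j\<close>: a labelled tree
  determines its history, so path functionals can be treated as functions of the last tree alone.
\<close>

definition deg_at :: "nat \<Rightarrow> nat \<Rightarrow> graph \<Rightarrow> nat" where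
  "deg_at j v g = card {e \<in> edges g. v \<in> e \<and> e \<subseteq> {..<j}}"

definition weight :: "nat \<Rightarrow> graph \<Rightarrow> real" where
  "weight j g = (\<Sum>v = 1..j - 1. real (deg_at j v g))"

text \<open>The factor at \<open>n\<close> is left out on purpose: the value at \<open>Suc n\<close>
  then depends only on the tree at time \<open>n\<close> and passes through \<open>step\<close> as a
  constant. The parameter \<open>c\<close> is the order of the rising factorial being normalised;
  the orders 1, k and -1/2 occur.\<close>

definition growth :: "real \<Rightarrow> real \<Rightarrow> nat \<Rightarrow> graph \<Rightarrow> real" where
  "growth p c n g = (\<Prod>j = 2..<n. 1 + c * (1 - p) / weight j g)"

text \<open>The conditional expectation of \<open>f (G (Suc n))\<close> given \<open>G n = g\<close>.\<close>

definition step :: "real \<Rightarrow> nat \<Rightarrow> (graph \<Rightarrow> real) \<Rightarrow> graph \<Rightarrow> real" where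
  "step p n f g = (\<Sum>i<n. attach_prob p n g i * f (attach g n i))"

lemma reachable_2: "reachable 2 = {({0, 1}, {{0, 1}})}"
  by (simp add: numeral_2_eq_2)

lemma reachable_Suc: "n \<ge> 2 \<Longrightarrow> reachable (Suc n) = (\<lambda>(g, i). attach g n i) ` (reachable n \<times> {..<n})"
  by simp

declare reachable.simps [simp del]

lemma reachable_induct [consumes 2, case_names base attach]:
  assumes "n \<ge> 2" and "g \<in> reachable n"
    and base: "P 2 ({0, 1}, {{0, 1}})"
    and step: "\<And>n g i. n \<ge> 2 \<Longrightarrow> g \<in> reachable n \<Longrightarrow> i < n \<Longrightarrow> P n g \<Longrightarrow> P (Suc n) (attach g n i)"
  shows "P n g"
  using assms(1,2)
proof (induction n arbitrary: g rule: nat_induct_at_least)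
  case base
  then show ?case using assms(3) by (simp add: reachable_2)
next
  case (Suc n)
  then show ?case using assms(4) by (auto simp: reachable_Suc)
qed

lemma finite_reachable: "finite (reachable n)"
  by (induction n) (simp_all add: reachable.simps)

lemma reachable_edge_subset: "n \<ge> 2 \<Longrightarrow> g \<in> reachable n \<Longrightarrow> e \<in> edges g \<Longrightarrow> e \<subseteq> {..<n}"
proof (induction arbitrary: e rule: reachable_induct)
  case base
  then show ?case by (auto simp: edges_def)
next
  case (attach n g i)
  have "e = {i, n} \<or> e \<in> edges g"
    using attach.prems by (auto simp: attach_def edges_def)
  then show ?case using attach.IH[of e] attach.hyps by (fastforce simp: less_Suc_eq)
qed

lemma finite_edges_reachable: "n \<ge> 2 \<Longrightarrow> g \<in> reachable n \<Longrightarrow> finite (edges g)"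
  by (rule finite_subset[of _ "Pow {..<n}"]) (use reachable_edge_subset in blast, simp)

lemma deg_at_reachable:
  assumes "n \<ge> 2" "g \<in> reachable n"
  shows "deg_at n v g = degree v g"
  unfolding deg_at_def degree_def
  by (rule arg_cong[where f = card]) (use reachable_edge_subset[OF assms] in blast)

lemma weight_reachable:
  assumes "n \<ge> 2" "g \<in> reachable n"
  shows "weight n g = (\<Sum>v = 1..n - 1. real (degree v g))"
  by (simp add: weight_def deg_at_reachable[OF assms])

lemma deg_at_reachable_new:
  assumes "n \<ge> 2" "g \<in> reachable n"
  shows "deg_at n n g = 0"
  unfolding deg_at_def by auto

lemma deg_at_attach_old: "j \<le> n \<Longrightarrow> deg_at j v (attach g n i) = deg_at j v g"
  unfolding deg_at_def by (rule arg_cong[where f = card]) (auto simp: attach_def edges_def)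

lemma deg_at_attach:
  assumes "n \<ge> 2" "g \<in> reachable n" "i < n"
  shows "deg_at (Suc n) v (attach g n i) = deg_at n v g + (if v = i \<or> v = n then 1 else 0)"
proof -
  let ?E = "{e \<in> edges g. v \<in> e}"
  have sub: "e \<subseteq> {..<n}" "e \<subseteq> {..<Suc n}" if "e \<in> edges g" for e
    using reachable_edge_subset[OF assms(1,2) that] by auto
  have new: "{i, n} \<notin> edges g" using sub(1) by auto
  have old: "{e \<in> edges g. v \<in> e \<and> e \<subseteq> {..<n}} = ?E" using sub(1) by blast
  have "edges (attach g n i) = insert {i, n} (edges g)"
    by (simp add: attach_def edges_def)
  moreover have "{i, n} \<subseteq> {..<Suc n}" using assms(3) by simp
  ultimately have "{e \<in> edges (attach g n i). v \<in> e \<and> e \<subseteq> {..<Suc n}} =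
        (if v = i \<or> v = n then insert {i, n} ?E else ?E)"
    using sub(2) by force
  moreover have "finite ?E" using finite_edges_reachable[OF assms(1,2)] by simp
  ultimately show ?thesis using new by (simp add: deg_at_def old)
qed

text \<open>The degree of \<open>i\<close> tells the two trees apart. This makes the attachment
  events for different targets disjoint, so that their probabilities may be added.\<close>

lemma attach_inj:
  assumes "n \<ge> 2" "g \<in> reachable n" "i < n" "j < n" "attach g n i = attach g n j"
  shows "i = j"
proof (rule ccontr)
  assume "i \<noteq> j"
  then show False
    using deg_at_attach[OF assms(1-3), of i] deg_at_attach[OF assms(1,2,4), of i] assms(3,5) by simp
qed

lemma weight_attach_old: "j \<le> n \<Longrightarrow> weight j (attach g n i) = weight j g"
  by (simp add: weight_def deg_at_attach_old)

lemma growth_attach: "j \<le> Suc n \<Longrightarrow> growth p c j (attach g n i) = growth p c j g"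
  unfolding growth_def by (intro prod.cong) (auto simp: weight_attach_old)

lemma growth_Suc: "n \<ge> 2 \<Longrightarrow> growth p c (Suc n) g = growth p c n g * (1 + c * (1 - p) / weight n g)"
  by (simp add: growth_def)

lemma growth_2: "growth p c 2 g = 1"
  by (simp add: growth_def)

lemma weight_attach:
  assumes "n \<ge> 2" "g \<in> reachable n" "i < n"
  shows "weight (Suc n) (attach g n i) = weight n g + (if i = 0 then 1 else 2)"
proof -
  obtain m where m: "n = Suc m" using assms(1) by (cases n) auto
  have "weight (Suc n) (attach g n i) =
        (\<Sum>v = 1..m. real (deg_at n v g) + (if v = i then 1 else 0)) + 1"
    using assms(3) by (simp add: weight_def deg_at_attach[OF assms, unfolded m] deg_at_reachable_new[OF assms(1,2), unfolded m] m)
      (intro sum.cong, auto)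
  also have "\<dots> = weight n g + (if i = 0 then 1 else 2)"
    using assms(3) by (auto simp: sum.distrib weight_def m sum.delta)
  finally show ?thesis .
qed

lemma deg_at_ge_1:
  "n \<ge> 2 \<Longrightarrow> g \<in> reachable n \<Longrightarrow> 1 \<le> v \<Longrightarrow> v < n \<Longrightarrow> deg_at n v g \<ge> 1"
proof (induction arbitrary: v rule: reachable_induct)
  case base
  then have "v = 1" by simp
  then have "{e \<in> edges ({0, 1}, {{0, 1}}). v \<in> e \<and> e \<subseteq> {..<2}} = {{0, 1}}"
    by (auto simp: edges_def)
  then show ?case by (simp add: deg_at_def)
next
  case (attach n g i)
  then show ?case
    by (cases "v = n") (auto simp: deg_at_attach)
qed

text \<open>A tree on n vertices has total degree 2 (n - 1), of which the superstar takes between 1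
  and n - 1. These bounds hold on every path, and both enter the estimates of
  \<open>growth\<close>.\<close>

lemma weight_bounds:
  "n \<ge> 2 \<Longrightarrow> g \<in> reachable n \<Longrightarrow> real n - 1 \<le> weight n g \<and> weight n g \<le> 2 * real n - 3"
proof (induction rule: reachable_induct)
  case base
  have "{e \<in> edges ({0, 1}, {{0, 1}}). 1 \<in> e \<and> e \<subseteq> {..<2}} = {{0, 1::nat}}"
    by (auto simp: edges_def)
  then show ?case by (simp add: weight_def deg_at_def numeral_2_eq_2)
next
  case (attach n g i)
  then show ?case by (auto simp: weight_attach)
qed

lemma weight_bounds_earlier:
  "n \<ge> 2 \<Longrightarrow> g \<in> reachable n \<Longrightarrow> 2 \<le> j \<Longrightarrow> j \<le> n \<Longrightarrow> real j - 1 \<le> weight j g \<and> weight j g \<le> 2 * real j - 3"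
proof (induction rule: reachable_induct)
  case base
  then show ?case using weight_bounds[of 2 "({0, 1}, {{0, 1}})"] by (simp add: reachable_2)
next
  case (attach n g i)
  show ?case
  proof (cases "j = Suc n")
    case True
    then show ?thesis
      using weight_bounds[of "Suc n" "attach g n i"] attach by (force simp: reachable_Suc)
  next
    case False
    then show ?thesis using attach by (simp add: weight_attach_old)
  qed
qed

section \<open>One-step expectations and the degree martingales\<close>

lemma step_eq:
  assumes "n \<ge> 2" "g \<in> reachable n"
  shows "step p n f g = p * f (attach g n 0) +
    (1 - p) / weight n g * (\<Sum>i = 1..n - 1. real (deg_at n i g) * f (attach g n i))"
proof -
  have "{..<n} = insert 0 {1..n - 1}" using assms(1) by auto
  then have "step p n f g = p * f (attach g n 0) + (\<Sum>i = 1..n - 1. attach_prob p n g i * f (attach g n i))"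
    by (simp add: step_def attach_prob_def)
  also have "(\<Sum>i = 1..n - 1. attach_prob p n g i * f (attach g n i)) =
     (\<Sum>i = 1..n - 1. (1 - p) / weight n g * (real (deg_at n i g) * f (attach g n i)))"
    by (intro sum.cong) (auto simp: attach_prob_def weight_reachable[OF assms] deg_at_reachable[OF assms])
  finally show ?thesis by (simp add: sum_distrib_left)
qed

lemma step_const:
  assumes "n \<ge> 2" "g \<in> reachable n"
  shows "step p n (\<lambda>_. c) g = c"
proof -
  have "weight n g > 0" using weight_bounds[OF assms] assms(1) by linarith
  moreover have "(\<Sum>i = 1..n - 1. real (deg_at n i g) * c) = weight n g * c"
    by (simp add: weight_def sum_distrib_right)
  ultimately show ?thesis by (simp add: step_eq[OF assms]) (simp add: algebra_simps)
qed

lemma step_add: "step p n (\<lambda>g. f g + h g) g = step p n f g + step p n h g"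
  by (simp add: step_def sum.distrib algebra_simps)

lemma step_cmult: "step p n (\<lambda>g. c * f g) g = c * step p n f g"
  by (simp add: step_def sum_distrib_left algebra_simps)

lemma step_sum: "step p n (\<lambda>g. \<Sum>l\<in>A. f l g) g = (\<Sum>l\<in>A. step p n (f l) g)"
  unfolding step_def sum_distrib_left by (rule sum.swap)

lemma step_cong: "(\<And>i. i < n \<Longrightarrow> f (attach g n i) = h (attach g n i)) \<Longrightarrow> step p n f g = step p n h g"
  by (simp add: step_def)

lemma attach_prob_nonneg:
  assumes "0 \<le> p" "p \<le> 1" shows "attach_prob p n g i \<ge> 0"
  using assms by (auto simp: attach_prob_def intro!: mult_nonneg_nonneg divide_nonneg_nonneg sum_nonneg)

lemma step_mono:
  assumes "0 \<le> p" "p \<le> 1" "\<And>i. i < n \<Longrightarrow> f (attach g n i) \<le> h (attach g n i)"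
  shows "step p n f g \<le> step p n h g"
  unfolding step_def by (intro sum_mono mult_left_mono attach_prob_nonneg) (use assms in auto)

text \<open>The vertex is chosen with probability (1 - p) d / S and then gains \<phi> d * c / d, so
  the degree cancels and the expected growth factor is the same for all vertices. The condition on
  \<phi> is the functional equation of Gamma (d + c) / Gamma d.\<close>

lemma step_degree:
  assumes g: "n \<ge> 2" "g \<in> reachable n" and v: "1 \<le> v" "v < n"
    and \<phi>: "\<And>d. d \<ge> 1 \<Longrightarrow> \<phi> (Suc d) = \<phi> d * (1 + c / real d)"
  shows "step p n (\<lambda>g'. \<phi> (deg_at (Suc n) v g')) g = \<phi> (deg_at n v g) * (1 + c * (1 - p) / weight n g)"
proof -
  define d where "d = deg_at n v g"
  have d: "d \<ge> 1" using deg_at_ge_1[OF g v] by (simp add: d_def)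
  have pos: "weight n g > 0" using weight_bounds[OF g] g(1) by linarith
  have inc: "\<phi> (Suc d) - \<phi> d = \<phi> d * c / real d" using \<phi>[OF d] d by (simp add: field_simps)
  have "\<phi> (deg_at (Suc n) v (attach g n i)) = \<phi> d + (if i = v then \<phi> (Suc d) - \<phi> d else 0)" if "i < n" for i
    using that v by (auto simp: deg_at_attach[OF g] d_def)
  then have "step p n (\<lambda>g'. \<phi> (deg_at (Suc n) v g')) g =
      (\<Sum>i<n. attach_prob p n g i * (\<phi> d + (if i = v then \<phi> (Suc d) - \<phi> d else 0)))"
    by (simp add: step_def)
  also have "\<dots> = step p n (\<lambda>_. \<phi> d) g + attach_prob p n g v * (\<phi> (Suc d) - \<phi> d)"
    using v by (simp add: step_def distrib_left sum.distrib if_distrib[of "\<lambda>x. _ * x"] sum.delta cong: if_cong)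
  also have "attach_prob p n g v = (1 - p) * real d / weight n g"
    using v by (simp add: attach_prob_def weight_reachable[OF g] d_def deg_at_reachable[OF g])
  finally show ?thesis
    using d pos by (simp add: step_const[OF g] inc flip: d_def) (simp add: field_simps)
qed

lemma growth_pos:
  assumes "0 < p" "p < 1" "c > -1" "n \<ge> 2" "g \<in> reachable n" "m \<le> Suc n"
  shows "growth p c m g > 0"
  unfolding growth_def
proof (rule prod_pos)
  fix j assume j: "j \<in> {2..<m}"
  have "weight j g \<ge> 1" using weight_bounds_earlier[OF assms(4,5), of j] j assms(6) by simp
  moreover have "c * (1 - p) > -1"
    using assms(1-3) mult_strict_right_mono[of "-1" c "1-p"] by (simp add: algebra_simps)
  ultimately have "c * (1 - p) + weight j g > 0" by linarith
  then show "0 < 1 + c * (1 - p) / weight j g"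
    using \<open>weight j g \<ge> 1\<close> by (simp add: field_simps)
qed

text \<open>The martingale property: the normaliser at \<open>Suc n\<close> is already known at time
  \<open>n\<close>, and its last factor is exactly the expected growth factor.\<close>

lemma step_scaled_degree:
  assumes p: "0 < p" "p < 1" and c: "c > -1" and g: "n \<ge> 2" "g \<in> reachable n" and v: "1 \<le> v" "v < n"
    and \<phi>: "\<And>d. d \<ge> 1 \<Longrightarrow> \<phi> (Suc d) = \<phi> d * (1 + c / real d)"
  shows "step p n (\<lambda>g'. \<phi> (deg_at (Suc n) v g') / growth p c (Suc n) g') g =
    \<phi> (deg_at n v g) / growth p c n g"
proof -
  have cancel: "inverse (x * r) * (y * r) = y / x" if "r \<noteq> 0" for x y r :: real
    using that by (simp add: divide_inverse)
  have "step p n (\<lambda>g'. \<phi> (deg_at (Suc n) v g') / growth p c (Suc n) g') g =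
     step p n (\<lambda>g'. inverse (growth p c (Suc n) g) * \<phi> (deg_at (Suc n) v g')) g"
    by (rule step_cong) (simp add: growth_attach divide_inverse)
  also have "\<dots> = inverse (growth p c (Suc n) g) *
      (\<phi> (deg_at n v g) * (1 + c * (1 - p) / weight n g))"
    by (simp only: step_cmult step_degree[where \<phi> = \<phi>, OF g v \<phi>])
  finally show ?thesis
    using growth_pos[OF p c g order_refl] cancel[of "1 + c * (1 - p) / weight n g"]
    by (cases "1 + c * (1 - p) / weight n g = 0") (simp_all only: growth_Suc[OF g(1), of p c g], simp)
qed

text \<open>Joining the superstar adds only the degree of the new vertex; any other choice also
  raises a counted degree. The increment is therefore 1 or 2 with probabilities that do not depend
  on the tree.\<close>

lemma step_weight:
  assumes g: "n \<ge> 2" "g \<in> reachable n"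
  shows "step p n (\<lambda>g'. h (weight (Suc n) g')) g = p * h (weight n g + 1) + (1 - p) * h (weight n g + 2)"
proof -
  have "(\<Sum>i = 1..n - 1. real (deg_at n i g) * h (weight (Suc n) (attach g n i))) =
        (\<Sum>i = 1..n - 1. real (deg_at n i g) * h (weight n g + 2))"
    by (intro sum.cong refl) (auto simp: weight_attach[OF g])
  also have "\<dots> = weight n g * h (weight n g + 2)"
    by (simp add: weight_def sum_distrib_right)
  finally show ?thesis
    using weight_bounds[OF g] g(1) weight_attach[OF g, of 0] by (simp add: step_eq[OF g])
qed

text \<open>The increment has mean p + 2 (1 - p) = 2 - p and variance p (1 - p), so centring removes
  the cross term.\<close>

lemma step_weight_variance:
  assumes g: "n \<ge> 2" "g \<in> reachable n"
  shows "step p n (\<lambda>g'. (weight (Suc n) g' - (2 - p) * real (Suc n))\<^sup>2) g =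
    (weight n g - (2 - p) * real n)\<^sup>2 + p * (1 - p)"
  by (subst step_weight[OF g, where h = "\<lambda>s. (s - (2 - p) * real (Suc n))\<^sup>2"])
     (simp add: power2_eq_square algebra_simps)

section \<open>The normalised maximum and the moments that dominate it\<close>

definition scaled_max :: "real \<Rightarrow> nat \<Rightarrow> graph \<Rightarrow> real" where
  "scaled_max p n g = real (Max ((\<lambda>v. deg_at n v g) ` {1..n - 1})) / growth p 1 n g"

definition moment :: "real \<Rightarrow> nat \<Rightarrow> nat \<Rightarrow> graph \<Rightarrow> real" where
  "moment p k n g = (\<Sum>v = 1..n - 1. pochhammer (real (deg_at n v g)) k / growth p (real k) n g)"

lemma scaled_max_attach: "j \<le> n \<Longrightarrow> scaled_max p j (attach g n i) = scaled_max p j g"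
  by (simp add: scaled_max_def growth_attach deg_at_attach_old)

lemma scaled_max_ge:
  assumes "0 < p" "p < 1" "n \<ge> 2" "g \<in> reachable n" "1 \<le> v" "v < n"
  shows "real (deg_at n v g) / growth p 1 n g \<le> scaled_max p n g"
  unfolding scaled_max_def using growth_pos[OF assms(1,2) _ assms(3,4), of 1 n] assms(5,6)
  by (intro divide_right_mono of_nat_mono Max_ge) auto

lemma scaled_max_attained:
  assumes "n \<ge> 2"
  obtains v where "1 \<le> v" "v < n" "scaled_max p n g = real (deg_at n v g) / growth p 1 n g"
proof -
  have "Max ((\<lambda>v. deg_at n v g) ` {1..n - 1}) \<in> (\<lambda>v. deg_at n v g) ` {1..n - 1}"
    using assms by (intro Max_in) auto
  then obtain v where "v \<in> {1..n - 1}" "Max ((\<lambda>v. deg_at n v g) ` {1..n - 1}) = deg_at n v g"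
    by blast
  then show thesis using assms that[of v] by (auto simp: scaled_max_def)
qed

text \<open>A vertex that attains the maximum at time \<open>n\<close> is followed for one step: its
  own ratio is a martingale and stays below the new maximum.\<close>

lemma step_scaled_max_ge:
  assumes p: "0 < p" "p < 1" and g: "n \<ge> 2" "g \<in> reachable n"
  shows "scaled_max p n g \<le> step p n (scaled_max p (Suc n)) g"
proof -
  obtain v where v: "1 \<le> v" "v < n" "scaled_max p n g = real (deg_at n v g) / growth p 1 n g"
    using scaled_max_attained[OF g(1)] .
  have "scaled_max p n g = step p n (\<lambda>g'. real (deg_at (Suc n) v g') / growth p 1 (Suc n) g') g"
    using step_scaled_degree[where \<phi> = real and c = 1, OF p _ g v(1,2)] v(3) by (simp add: field_simps)
  also have "\<dots> \<le> step p n (scaled_max p (Suc n)) g"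
  proof (intro step_mono)
    fix i assume "i < n"
    then have "attach g n i \<in> reachable (Suc n)" using g by (auto simp: reachable_Suc)
    then show "real (deg_at (Suc n) v (attach g n i)) / growth p 1 (Suc n) (attach g n i) \<le>
        scaled_max p (Suc n) (attach g n i)"
      using scaled_max_ge[OF p, of "Suc n"] v(1,2) g(1) by simp
  qed (use p in auto)
  finally show ?thesis .
qed

lemma pochhammer_Suc_arg:
  fixes d :: nat assumes "d \<ge> 1"
  shows "pochhammer (real (Suc d)) k = pochhammer (real d) k * (1 + real k / real d)"
  using assms pochhammer_rec[of "real d" k] pochhammer_Suc[of "real d" k] by (simp add: field_simps)

text \<open>The old vertices contribute martingales. The excess comes from the newborn vertex, whose
  degree 1 has rising factorial k!.\<close>

lemma step_moment:
  assumes p: "0 < p" "p < 1" and g: "n \<ge> 2" "g \<in> reachable n"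
  shows "step p n (moment p k (Suc n)) g = moment p k n g + fact k / growth p (real k) (Suc n) g"
proof -
  let ?t = "\<lambda>v g'. pochhammer (real (deg_at (Suc n) v g')) k / growth p (real k) (Suc n) g'"
  obtain m where m: "n = Suc m" using g(1) by (cases n) auto
  have "step p n (moment p k (Suc n)) g = step p n (\<lambda>g'. (\<Sum>v = 1..n - 1. ?t v g') + ?t n g') g"
    by (rule step_cong) (simp add: moment_def m)
  also have "\<dots> = (\<Sum>v = 1..n - 1. step p n (?t v) g) + step p n (?t n) g"
    by (simp only: step_add step_sum)
  also have "(\<Sum>v = 1..n - 1. step p n (?t v) g) = moment p k n g"
    unfolding moment_def
    by (intro sum.cong refl step_scaled_degree[where \<phi> = "\<lambda>d. pochhammer (real d) k", OF p _ g])
       (auto simp: pochhammer_Suc_arg simp del: of_nat_Suc)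
  also have "step p n (?t n) g = step p n (\<lambda>_. fact k / growth p (real k) (Suc n) g) g"
    by (rule step_cong)
       (simp add: deg_at_attach[OF g] deg_at_reachable_new[OF g] growth_attach pochhammer_fact)
  finally show ?thesis by (simp add: step_const[OF g])
qed

text \<open>With \<open>weight m g\<close> below 2 m, each factor is at least 1 + 2 / m = (m + 2) /
  m, and the product of these telescopes. The divisor 6 makes the bound an equality at m =
  2.\<close>

lemma growth_ge:
  assumes p: "0 < p" "p < 1" and c: "c * (1 - p) \<ge> 4" and g: "n \<ge> 2" "g \<in> reachable n"
    and "2 \<le> m" "m \<le> Suc n"
  shows "growth p c m g \<ge> real m * (real m + 1) / 6"
  using \<open>2 \<le> m\<close> \<open>m \<le> Suc n\<close>
proof (induction m rule: nat_induct_at_least)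
  case base
  then show ?case by (simp add: growth_2)
next
  case (Suc m)
  have w: "real m - 1 \<le> weight m g" "weight m g \<le> 2 * real m - 3"
    using weight_bounds_earlier[OF g, of m] Suc.hyps Suc.prems by auto
  have "real (Suc m) * (real (Suc m) + 1) / 6 = real m * (real m + 1) / 6 * (1 + 4 / (2 * real m))"
    using Suc.hyps by (simp add: field_simps)
  also have "4 / (2 * real m) \<le> c * (1 - p) / weight m g"
    using w c Suc.hyps by (intro frac_le) auto
  then have "real m * (real m + 1) / 6 * (1 + 4 / (2 * real m)) \<le> growth p c m g * (1 + c * (1 - p) / weight m g)"
    using Suc.IH Suc.prems by (intro mult_mono) (auto intro: order_trans[of 0 "real m * (real m + 1) / 6"])
  finally show ?case using Suc.hyps by (simp add: growth_Suc)
qed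

lemma power_le_pochhammer: "real d ^ k \<le> pochhammer (real d) k"
proof (induction k)
  case (Suc k)
  have "real d ^ k * real d \<le> pochhammer (real d) k * (real d + real k)"
    using Suc by (intro mult_mono) (auto intro: pochhammer_nonneg order_trans[OF _ Suc])
  then show ?case by (simp add: pochhammer_Suc mult.commute)
qed simp

text \<open>Bernoulli's inequality in each factor. The products stand in denominators later, so this
  direction bounds a power of the normalised degree by the normalised rising factorial.\<close>

lemma growth_le_power:
  assumes p: "0 < p" "p < 1" and g: "n \<ge> 2" "g \<in> reachable n"
  shows "growth p (real k) n g \<le> growth p 1 n g ^ k"
  unfolding growth_def prod_power_distrib
proof (intro prod_mono conjI)
  fix j assume "j \<in> {2..<n}"
  then have "weight j g > 0" using weight_bounds_earlier[OF g, of j] by auto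
  then have "0 \<le> (1 - p) / weight j g" using p by simp
  then show "1 + real k * (1 - p) / weight j g \<le> (1 + 1 * (1 - p) / weight j g) ^ k"
    using Bernoulli_inequality[of "(1 - p) / weight j g" k] by simp
  show "0 \<le> 1 + real k * (1 - p) / weight j g" using \<open>0 < weight j g\<close> p by simp
qed

lemma moment_nonneg:
  assumes p: "0 < p" "p < 1" and g: "n \<ge> 2" "g \<in> reachable n"
  shows "moment p k n g \<ge> 0"
  unfolding moment_def using growth_pos[OF p _ g, of "real k" n]
  by (intro sum_nonneg divide_nonneg_pos pochhammer_nonneg) (use deg_at_ge_1[OF g] in \<open>force+\<close>)

lemma scaled_max_nonneg:
  assumes p: "0 < p" "p < 1" and g: "n \<ge> 2" "g \<in> reachable n"
    and m: "m \<le> n"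
  shows "scaled_max p m g \<ge> 0"
  unfolding scaled_max_def using growth_pos[OF p _ g, of 1 m] m by simp

text \<open>The \<open>k\<close>-th power of the maximum is bounded by a single summand of the
  moment; the square is at most 1 or at most the \<open>k\<close>-th power.\<close>

lemma scaled_max_square_le:
  assumes p: "0 < p" "p < 1" and g: "n \<ge> 2" "g \<in> reachable n" and k: "k \<ge> 2"
  shows "(scaled_max p n g)\<^sup>2 \<le> 1 + moment p k n g"
proof -
  obtain v where v: "1 \<le> v" "v < n" "scaled_max p n g = real (deg_at n v g) / growth p 1 n g"
    using scaled_max_attained[OF g(1)] .
  have pos: "growth p 1 n g > 0" "growth p (real k) n g > 0"
    using growth_pos[OF p _ g, of _ n] by auto
  have poch: "pochhammer (real (deg_at n u g)) k \<ge> 0" for u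
    using power_le_pochhammer[of "deg_at n u g" k] by (rule order_trans[rotated]) simp
  have "scaled_max p n g ^ k = real (deg_at n v g) ^ k / growth p 1 n g ^ k"
    by (simp add: v(3) power_divide)
  also have "\<dots> \<le> pochhammer (real (deg_at n v g)) k / growth p (real k) n g"
    using power_le_pochhammer growth_le_power[OF p g] pos poch by (intro frac_le) auto
  also have "\<dots> \<le> moment p k n g"
    unfolding moment_def using v poch pos by (intro member_le_sum) auto
  finally have *: "scaled_max p n g ^ k \<le> moment p k n g" .
  show ?thesis
  proof (cases "scaled_max p n g \<le> 1")
    case True
    then have "(scaled_max p n g)\<^sup>2 \<le> 1" using scaled_max_nonneg[OF p g order_refl] by (simp add: power_le_one)
    then show ?thesis using moment_nonneg[OF p g, of k] by linarith
  next
    case False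
    then have "(scaled_max p n g)\<^sup>2 \<le> scaled_max p n g ^ k" using k by (intro power_increasing) auto
    then show ?thesis using * by linarith
  qed
qed

section \<open>A negative moment of the degree of the first nonsuperstar\<close>

text \<open>
  Up to a constant this is \<open>\<Gamma> (d - 1 / 2) / \<Gamma> d\<close>, the rising factorial of order \<open>- 1 / 2\<close>.
\<close>

definition half_factorial :: "nat \<Rightarrow> real" where
  "half_factorial d = (\<Prod>j = 1..<d. 1 + (- 1 / 2) / real j)"

lemma half_factorial_Suc: "d \<ge> 1 \<Longrightarrow> half_factorial (Suc d) = half_factorial d * (1 + (- 1 / 2) / real d)"
  by (simp add: half_factorial_def)

lemma half_factorial_ge: "d \<ge> 1 \<Longrightarrow> 1 \<le> 4 * real d * (half_factorial d)\<^sup>2"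
proof -
  \<comment> \<open>The claim itself does not pass through the induction, since d times the squared
    factorial decreases. With d - 1 in place of d the sequence increases, because d (1 - 1 / (2
    d))^2 = d - 1 + 1 / (4 d), and it starts at equality for d = 2.\<close>
  have *: "1 \<le> 4 * (real d - 1) * (half_factorial d)\<^sup>2" if "d \<ge> 2"
    using that
  proof (induction d rule: nat_induct_at_least)
    case base
    show ?case by (simp add: half_factorial_def numeral_2_eq_2 power2_eq_square)
  next
    case (Suc d)
    have "(real d - 1) * (half_factorial d)\<^sup>2 \<le> real d * (1 + (- 1 / 2) / real d)\<^sup>2 * (half_factorial d)\<^sup>2"
      using Suc.hyps by (intro mult_right_mono) (auto simp: field_simps power2_eq_square)
    then have "(real d - 1) * (half_factorial d)\<^sup>2 \<le> (real (Suc d) - 1) * (half_factorial (Suc d))\<^sup>2"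
      using Suc.hyps by (simp add: half_factorial_Suc power_mult_distrib mult_ac)
    then show ?case using Suc.IH unfolding mult.assoc by linarith
  qed
  assume "d \<ge> 1"
  show ?thesis
  proof (cases "d \<ge> 2")
    case True
    have "4 * (real d - 1) * (half_factorial d)\<^sup>2 \<le> 4 * real d * (half_factorial d)\<^sup>2"
      by (intro mult_right_mono) auto
    then show ?thesis using *[OF True] by linarith
  next
    case False
    then have "d = 1" using \<open>d \<ge> 1\<close> by simp
    then show ?thesis by (simp add: half_factorial_def)
  qed
qed

text \<open>With a = (1 - p) / S_j each factor is (1 - a / 2)^2 (1 + a) = 1 - a^2 (3 - a) / 4, which
  is at most 1 for a in [0, 1].\<close>

lemma growth_neg_half_le:
  assumes p: "0 < p" "p < 1" and g: "n \<ge> 2" "g \<in> reachable n"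
  shows "(growth p (- 1 / 2) n g)\<^sup>2 * growth p 1 n g \<le> 1"
  unfolding growth_def prod_power_distrib prod.distrib[symmetric]
proof (intro prod_le_1 conjI)
  fix j assume "j \<in> {2..<n}"
  then have w: "weight j g \<ge> 1" using weight_bounds_earlier[OF g, of j] by auto
  define a where "a = (1 - p) / weight j g"
  have a: "0 \<le> a" "a \<le> 1" using p w by (auto simp: a_def divide_le_eq)
  have eq: "(1 + - 1 / 2 * (1 - p) / weight j g)\<^sup>2 * (1 + 1 * (1 - p) / weight j g) =
      (1 - a / 2)\<^sup>2 * (1 + a)"
    by (simp add: a_def mult.commute)
  have "(1 - a / 2)\<^sup>2 * (1 + a) = 1 - a\<^sup>2 * (3 - a) / 4"
    by (simp add: field_simps power2_eq_square)
  also have "\<dots> \<le> 1" using a by simp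
  finally show "(1 + - 1 / 2 * (1 - p) / weight j g)\<^sup>2 * (1 + 1 * (1 - p) / weight j g) \<le> 1"
    unfolding eq .
  show "0 \<le> (1 + - 1 / 2 * (1 - p) / weight j g)\<^sup>2 * (1 + 1 * (1 - p) / weight j g)"
    unfolding eq using a by simp
qed

definition negmoment :: "real \<Rightarrow> nat \<Rightarrow> graph \<Rightarrow> real" where
  "negmoment p n g = half_factorial (deg_at n 1 g) / growth p (- 1 / 2) n g"

lemma step_negmoment:
  assumes p: "0 < p" "p < 1" and g: "n \<ge> 2" "g \<in> reachable n"
  shows "step p n (negmoment p (Suc n)) g = negmoment p n g"
  unfolding negmoment_def using g(1)
  by (intro step_scaled_degree[where \<phi> = half_factorial, OF p _ g]) (auto simp: half_factorial_Suc)

text \<open>In other words, the martingale \<open>negmoment\<close> is at least half the maximum to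
  the power -1/2, so a small maximum forces a large value of a variable with mean 1.\<close>

lemma scaled_max_negmoment:
  assumes p: "0 < p" "p < 1" and g: "n \<ge> 2" "g \<in> reachable n"
  shows "1 \<le> 4 * (negmoment p n g)\<^sup>2 * scaled_max p n g"
proof -
  let ?d = "deg_at n 1 g"
  let ?G = "growth p (- 1 / 2) n g"
  have d: "?d \<ge> 1" using deg_at_ge_1[OF g, of 1] g(1) by simp
  have pos: "growth p 1 n g > 0" "?G > 0" using growth_pos[OF p _ g, of _ n] by auto
  have "1 \<le> 1 / (?G\<^sup>2 * growth p 1 n g)"
    using growth_neg_half_le[OF p g] pos by simp
  also have "\<dots> \<le> 4 * real ?d * (half_factorial ?d)\<^sup>2 / (?G\<^sup>2 * growth p 1 n g)"
    using half_factorial_ge[OF d] pos by (intro divide_right_mono) auto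
  also have "\<dots> = 4 * (negmoment p n g)\<^sup>2 * (real ?d / growth p 1 n g)"
    by (simp add: negmoment_def power_divide)
  also have "\<dots> \<le> 4 * (negmoment p n g)\<^sup>2 * scaled_max p n g"
    using scaled_max_ge[OF p g, of 1] g(1) by (intro mult_left_mono) auto
  finally show ?thesis .
qed

lemma negmoment_nonneg:
  assumes p: "0 < p" "p < 1" and g: "n \<ge> 2" "g \<in> reachable n"
  shows "negmoment p n g \<ge> 0"
  unfolding negmoment_def half_factorial_def using growth_pos[OF p _ g, of "- 1 / 2" n]
  by (intro divide_nonneg_pos prod_nonneg) auto

lemma deg_at_edge: "deg_at 2 1 ({0, 1}, {{0, 1}}) = 1"
proof -
  have "{e \<in> edges ({0, 1}, {{0, 1}}). 1 \<in> e \<and> e \<subseteq> {..<2}} = {{0, 1::nat}}"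
    by (auto simp: edges_def)
  then show ?thesis by (simp add: deg_at_def)
qed

section \<open>Logarithms of the growth factors\<close>

text \<open>If w were exactly (2 - p) N, then (1 - p) / w would be gamma / N; the first error term
  is the deviation from this, using w >= N / 2 and gamma <= 1/2. The constant 5 collects the
  quadratic errors of the two logarithms: 4 from (1 - p) / w <= 2 / N, and 1 from ln (1 + 1 /
  N).\<close>

lemma ln_growth_factor_bound:
  fixes p w N :: real
  assumes p: "0 < p" "p < 1" and N: "N \<ge> 2" and w: "w \<ge> N - 1"
  shows "\<bar>ln (1 + (1 - p) / w) - (1 - p) / (2 - p) * (ln (N + 1) - ln N)\<bar> \<le>
    \<bar>w - (2 - p) * N\<bar> / N\<^sup>2 + 5 / N\<^sup>2"
proof -
  define x where "x = (1 - p) / w"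
  define \<gamma> where "\<gamma> = (1 - p) / (2 - p)"
  have w2: "w \<ge> N / 2" "w \<ge> 1" using w N by auto
  have \<gamma>: "0 \<le> \<gamma>" "\<gamma> \<le> 1 / 2" using p by (auto simp: \<gamma>_def field_simps)
  have x0: "0 \<le> x" using p w2 by (simp add: x_def)
  have x1: "x \<le> 1" using p w2 by (simp add: x_def divide_le_eq)
  have "x \<le> 1 / (N / 2)" unfolding x_def using p w2 N by (intro frac_le) auto
  then have "x\<^sup>2 \<le> (2 / N)\<^sup>2" using x0 by (intro power_mono) auto
  then have x2: "x\<^sup>2 \<le> 4 / N\<^sup>2" by (simp add: power_divide)
  have a: "\<bar>ln (1 + x) - x\<bar> \<le> x\<^sup>2" using x0 x1 by (rule abs_ln_one_plus_x_minus_x_bound_nonneg)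
  have "ln (N + 1) - ln N = ln (1 + 1 / N)"
    using N ln_div[of "N + 1" N] by (simp add: add_divide_distrib)
  then have b: "\<bar>(ln (N + 1) - ln N) - 1 / N\<bar> \<le> 1 / N\<^sup>2"
    using abs_ln_one_plus_x_minus_x_bound_nonneg[of "1 / N"] N by (simp add: power_divide)
  have "\<bar>\<gamma> * ((ln (N + 1) - ln N) - 1 / N)\<bar> \<le> 1 * (1 / N\<^sup>2)"
    unfolding abs_mult using \<gamma> b by (intro mult_mono) auto
  then have b': "\<bar>\<gamma> * (ln (N + 1) - ln N) - \<gamma> / N\<bar> \<le> 1 / N\<^sup>2"
    by (simp add: right_diff_distrib)
  have "x - \<gamma> / N = \<gamma> * ((2 - p) * N - w) / (w * N)"
    using p w2 N by (simp add: x_def \<gamma>_def divide_simps) (simp add: algebra_simps)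
  then have "\<bar>x - \<gamma> / N\<bar> = \<gamma> * \<bar>w - (2 - p) * N\<bar> / (w * N)"
    using \<gamma> w2 N by (simp add: abs_mult abs_minus_commute)
  also have "\<dots> \<le> (1 / 2) * \<bar>w - (2 - p) * N\<bar> / ((N / 2) * N)"
    using \<gamma> w2 N by (intro frac_le mult_mono mult_right_mono) auto
  also have "\<dots> = \<bar>w - (2 - p) * N\<bar> / N\<^sup>2" by (simp add: power2_eq_square)
  finally have c: "\<bar>x - \<gamma> / N\<bar> \<le> \<bar>w - (2 - p) * N\<bar> / N\<^sup>2" .
  have "5 / N\<^sup>2 = 4 / N\<^sup>2 + 1 / N\<^sup>2" by (simp add: add_divide_distrib[symmetric])
  then have "\<bar>ln (1 + x) - \<gamma> * (ln (N + 1) - ln N)\<bar> \<le> \<bar>w - (2 - p) * N\<bar> / N\<^sup>2 + 5 / N\<^sup>2"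
    using a b' c x2 by linarith
  then show ?thesis by (simp add: x_def \<gamma>_def)
qed

section \<open>The random trees\<close>

locale superstar = superstar_model +
  assumes p_pos: "0 < p" and p_less_1: "p < 1"
begin

definition EG :: "nat \<Rightarrow> (graph \<Rightarrow> real) \<Rightarrow> real" where
  "EG n f = expectation (\<lambda>\<omega>. f (G n \<omega>))"

lemma measurable_G [measurable]: "n \<ge> 1 \<Longrightarrow> (\<lambda>\<omega>. f (G n \<omega>)) \<in> measurable M (count_space UNIV)"
  by (rule measurable_compose[OF random_graph]) auto

lemma borel_measurable_G [measurable]: "n \<ge> 1 \<Longrightarrow> (\<lambda>\<omega>. f (G n \<omega>) :: real) \<in> borel_measurable M"
  by (rule measurable_compose[OF random_graph]) auto

lemma sets_G: "n \<ge> 1 \<Longrightarrow> {\<omega> \<in> space M. G n \<omega> = g} \<in> events"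
  using measurable_G[of n "\<lambda>x. x = g"] by (simp add: pred_def)

text \<open>The transition rule multiplied out, which makes it valid for trees of probability zero
  too.\<close>

lemma prob_attach:
  assumes "n \<ge> 2" "i < n"
  shows "prob {\<omega> \<in> space M. G (Suc n) \<omega> = attach g n i \<and> G n \<omega> = g} =
    attach_prob p n g i * prob {\<omega> \<in> space M. G n \<omega> = g}"
proof (cases "prob {\<omega> \<in> space M. G n \<omega> = g} = 0")
  case True
  have "prob {\<omega> \<in> space M. G (Suc n) \<omega> = attach g n i \<and> G n \<omega> = g} \<le> prob {\<omega> \<in> space M. G n \<omega> = g}"
    using assms by (intro finite_measure_mono sets_G) auto
  then have "prob {\<omega> \<in> space M. G (Suc n) \<omega> = attach g n i \<and> G n \<omega> = g} = 0"
    unfolding True by (intro antisym measure_nonneg)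
  then show ?thesis using True by simp
next
  case False
  then have "prob {\<omega> \<in> space M. G n \<omega> = g} > 0" by (simp add: zero_less_measure_iff)
  with transition[OF assms this] show ?thesis by (simp add: cond_prob_def field_simps)
qed

text \<open>The model gives only the probabilities of the prescribed attachments. That nothing else
  happens follows because these disjoint events have total probability 1.\<close>

lemma AE_reachable_attach:
  assumes "n \<ge> 2" and R: "AE \<omega> in M. G n \<omega> \<in> reachable n"
  shows "AE \<omega> in M. \<exists>i<n. G (Suc n) \<omega> = attach (G n \<omega>) n i"
proof -
  let ?D = "\<lambda>(g, i). {\<omega> \<in> space M. G (Suc n) \<omega> = attach g n i \<and> G n \<omega> = g}"
  let ?I = "reachable n \<times> {..<n}"
  have D: "?D x \<in> events" for x
    using assms(1) by (cases x) (simp add: sets.sets_Collect_conj sets_G)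
  have fin: "finite ?I" by (simp add: finite_reachable)
  have "disjoint_family_on ?D ?I"
    unfolding disjoint_family_on_def
  proof (intro ballI impI)
    fix x y assume xy: "x \<in> ?I" "y \<in> ?I" "x \<noteq> y"
    show "?D x \<inter> ?D y = {}"
    proof (rule equals0I)
      fix \<omega> assume "\<omega> \<in> ?D x \<inter> ?D y"
      then have "fst x = fst y" "attach (fst x) n (snd x) = attach (fst x) n (snd y)"
        by (auto simp: case_prod_beta)
      with xy show False
        using attach_inj[OF assms(1), of "fst x" "snd x" "snd y"] by (metis SigmaE lessThan_iff fst_conv snd_conv)
    qed
  qed
  then have "prob (\<Union> (?D ` ?I)) = (\<Sum>x\<in>?I. prob (?D x))"
    using fin D by (intro finite_measure_finite_Union) auto
  also have "\<dots> = (\<Sum>g\<in>reachable n. \<Sum>i<n. attach_prob p n g i * prob {\<omega> \<in> space M. G n \<omega> = g})"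
    unfolding sum.cartesian_product by (intro sum.cong refl) (auto simp: prob_attach[OF assms(1)])
  also have "\<dots> = (\<Sum>g\<in>reachable n. prob {\<omega> \<in> space M. G n \<omega> = g})"
    using step_const[OF assms(1), of _ p 1]
    by (intro sum.cong refl) (simp add: step_def sum_distrib_right[symmetric])
  also have "\<dots> = prob (\<Union>g\<in>reachable n. {\<omega> \<in> space M. G n \<omega> = g})"
    using assms(1) sets_G finite_reachable
    by (intro finite_measure_finite_Union[symmetric]) (auto simp: disjoint_family_on_def)
  also have "\<dots> = 1"
    using assms(1) sets_G finite_reachable R
    by (subst prob_eq_1) (auto intro!: sets.finite_UN)
  finally have "AE \<omega> in M. \<omega> \<in> \<Union> (?D ` ?I)"
    using D fin by (intro iffD1[OF prob_eq_1] sets.finite_UN) simp_all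
  then show ?thesis
  proof eventually_elim
    case (elim \<omega>)
    then obtain x where x: "x \<in> ?I" "\<omega> \<in> ?D x" by blast
    then have "snd x < n" "G (Suc n) \<omega> = attach (G n \<omega>) n (snd x)" by (auto simp: case_prod_beta)
    then show ?case by blast
  qed
qed

lemma AE_reachable: "n \<ge> 2 \<Longrightarrow> AE \<omega> in M. G n \<omega> \<in> reachable n"
proof (induction n rule: nat_induct_at_least)
  case base
  then show ?case using initial_2 by (simp add: reachable_2)
next
  case (Suc n)
  show ?case
    using AE_reachable_attach[OF Suc.hyps Suc.IH] Suc.IH
    by eventually_elim (use Suc.hyps in \<open>auto simp: reachable_Suc\<close>)
qed

lemma AE_attach:
  "n \<ge> 2 \<Longrightarrow> AE \<omega> in M. G n \<omega> \<in> reachable n \<and> (\<exists>i<n. G (Suc n) \<omega> = attach (G n \<omega>) n i)"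
  by (intro AE_conjI AE_reachable_attach AE_reachable)

lemma integrable_G:
  assumes "n \<ge> 2" shows "integrable M (\<lambda>\<omega>. f (G n \<omega>) :: real)"
proof (rule integrable_const_bound)
  show "AE \<omega> in M. norm (f (G n \<omega>)) \<le> (\<Sum>g\<in>reachable n. \<bar>f g\<bar>)"
    using AE_reachable[OF assms]
    by eventually_elim (auto intro!: member_le_sum[of _ _ "\<lambda>g. \<bar>f g\<bar>"] finite_reachable)
qed (use assms in \<open>auto intro!: borel_measurable_G\<close>)

lemma EG_mono:
  assumes "n \<ge> 2" "\<And>g. g \<in> reachable n \<Longrightarrow> f g \<le> h g"
  shows "EG n f \<le> EG n h"
  unfolding EG_def using AE_reachable[OF assms(1)]
  by (intro integral_mono_AE integrable_G assms(1)) (auto elim!: eventually_mono assms(2))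

lemma EG_cong:
  assumes "n \<ge> 2" "\<And>g. g \<in> reachable n \<Longrightarrow> f g = h g"
  shows "EG n f = EG n h"
  by (intro antisym EG_mono) (auto simp: assms)

lemma EG_add: "n \<ge> 2 \<Longrightarrow> EG n (\<lambda>g. f g + h g) = EG n f + EG n h"
  unfolding EG_def by (intro Bochner_Integration.integral_add integrable_G)

lemma EG_cmult: "EG n (\<lambda>g. c * f g) = c * EG n f"
  unfolding EG_def by simp

lemma EG_const: "EG n (\<lambda>_. c) = c"
  unfolding EG_def by (simp add: prob_space)

lemma EG_2: "EG 2 f = f ({0, 1}, {{0, 1}})"
  using EG_cong[of 2 f "\<lambda>_. f ({0, 1}, {{0, 1}})"] by (simp add: reachable_2 EG_const)

text \<open>The tower property, reduced to finite sums over pairs of a tree and an attachment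
  target.\<close>

lemma EG_Suc:
  assumes "n \<ge> 2"
  shows "EG (Suc n) f = EG n (step p n f)"
proof -
  let ?D = "\<lambda>g i. {\<omega> \<in> space M. G (Suc n) \<omega> = attach g n i \<and> G n \<omega> = g}"
  have D: "?D g i \<in> events" for g i
    using assms by (simp add: sets.sets_Collect_conj sets_G)
  have int: "integrable M (\<lambda>\<omega>. c * indicator (?D g i) \<omega>)" for c :: real and g i
    using D[of g i] by (intro integrable_mult_right integrable_real_indicator) (auto simp: emeasure_eq_measure)
  have exp: "expectation (\<lambda>\<omega>. c * indicator A \<omega>) = c * prob A" if "A \<in> events" for c :: real and A
    using that by (subst integral_mult_right_zero) simp
  have int': "integrable M (\<lambda>\<omega>. c * indicator {\<omega> \<in> space M. G n \<omega> = g} \<omega>)" for c :: real and g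
    using sets_G[of n g] assms
    by (intro integrable_mult_right integrable_real_indicator) (auto simp: emeasure_eq_measure)
  have "EG (Suc n) f = expectation (\<lambda>\<omega>. \<Sum>g\<in>reachable n. \<Sum>i<n. f (attach g n i) * indicator (?D g i) \<omega>)"
    unfolding EG_def
  proof (rule integral_cong_AE)
    show "AE \<omega> in M. f (G (Suc n) \<omega>) = (\<Sum>g\<in>reachable n. \<Sum>i<n. f (attach g n i) * indicator (?D g i) \<omega>)"
      using AE_attach[OF assms] AE_space
    proof eventually_elim
      case (elim \<omega>)
      then obtain i where i: "i < n" "G (Suc n) \<omega> = attach (G n \<omega>) n i" by blast
      \<comment> \<open>By \<open>attach_inj\<close> exactly one pair is active at this outcome, so
        the double sum collapses to one term.\<close>
      have "indicator (?D g j) \<omega> = (if g = G n \<omega> then if j = i then 1 else 0 else (0::real))"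
        if "g \<in> reachable n" "j < n" for g j
        using attach_inj[OF assms, of g j i] that i elim by (auto simp: indicator_def)
      then have "(\<Sum>g\<in>reachable n. \<Sum>j<n. f (attach g n j) * indicator (?D g j) \<omega>) =
          (\<Sum>g\<in>reachable n. if g = G n \<omega> then \<Sum>j<n. if j = i then f (attach g n j) else 0 else 0)"
        by (auto intro!: sum.cong simp: if_distrib[of "\<lambda>x. _ * x"] cong: if_cong)
      also have "\<dots> = f (G (Suc n) \<omega>)"
        using elim i by (simp add: sum.delta finite_reachable)
      finally show ?case ..
    qed
  next
    show "(\<lambda>\<omega>. \<Sum>g\<in>reachable n. \<Sum>i<n. f (attach g n i) * indicator (?D g i) \<omega>) \<in> borel_measurable M"
      by (intro borel_measurable_integrable Bochner_Integration.integrable_sum int)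
  qed (use assms in \<open>auto intro!: borel_measurable_G\<close>)
  also have "\<dots> = (\<Sum>g\<in>reachable n. \<Sum>i<n. f (attach g n i) * prob (?D g i))"
    by (simp only: Bochner_Integration.integral_sum Bochner_Integration.integrable_sum int exp[OF D])
  also have "\<dots> = (\<Sum>g\<in>reachable n. step p n f g * prob {\<omega> \<in> space M. G n \<omega> = g})"
    by (intro sum.cong refl) (simp add: step_def prob_attach[OF assms] sum_distrib_left mult_ac)
  also have "\<dots> = expectation (\<lambda>\<omega>. \<Sum>g\<in>reachable n. step p n f g * indicator {\<omega> \<in> space M. G n \<omega> = g} \<omega>)"
    using assms by (simp only: Bochner_Integration.integral_sum int' exp[OF sets_G])
  also have "\<dots> = EG n (step p n f)"
    unfolding EG_def
  proof (rule integral_cong_AE)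
    show "AE \<omega> in M. (\<Sum>g\<in>reachable n. step p n f g * indicator {\<omega> \<in> space M. G n \<omega> = g} \<omega>) = step p n f (G n \<omega>)"
      using AE_reachable[OF assms] AE_space
    proof eventually_elim
      case (elim \<omega>)
      then have "(\<Sum>g\<in>reachable n. step p n f g * indicator {\<omega> \<in> space M. G n \<omega> = g} \<omega>) =
          (\<Sum>g\<in>reachable n. if g = G n \<omega> then step p n f g else 0)"
        by (intro sum.cong) (auto simp: indicator_def)
      then show ?case using elim by (simp add: finite_reachable)
    qed
  next
    show "(\<lambda>\<omega>. \<Sum>g\<in>reachable n. step p n f g * indicator {\<omega> \<in> space M. G n \<omega> = g} \<omega>) \<in> borel_measurable M"
      by (intro borel_measurable_integrable Bochner_Integration.integrable_sum int')
  qed (use assms in \<open>auto intro!: borel_measurable_G\<close>)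
  finally show ?thesis .
qed

lemma markov_G:
  assumes "n \<ge> 2" "c > 0" "\<And>g. g \<in> reachable n \<Longrightarrow> f g \<ge> 0"
  shows "prob {\<omega> \<in> space M. c \<le> f (G n \<omega>)} \<le> EG n f / c"
  unfolding EG_def using AE_reachable[OF assms(1)] assms(1,2)
  by (intro integral_Markov_inequality_measure[where A = "space M", simplified] integrable_G)
     (auto elim!: eventually_mono intro: assms(3))

text \<open>Stability under later attachments expresses that \<open>f\<close> depends only on the
  past. It lets a quantity of time \<open>n\<close> be read off the later tree, so that two times
  can be compared on one tree.\<close>

lemma AE_stable:
  assumes "n \<ge> 2" "n \<le> m" and stable: "\<And>m g i. n \<le> m \<Longrightarrow> f (attach g m i) = f g"
  shows "AE \<omega> in M. f (G m \<omega>) = f (G n \<omega>)"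
  using assms(2)
proof (induction m rule: dec_induct)
  case (step m)
  then have "AE \<omega> in M. G m \<omega> \<in> reachable m \<and> (\<exists>i<m. G (Suc m) \<omega> = attach (G m \<omega>) m i)"
    using assms(1) by (intro AE_attach) simp
  then show ?case
    using step.IH
  proof eventually_elim
    case (elim \<omega>)
    then obtain i where "G (Suc m) \<omega> = attach (G m \<omega>) m i" by blast
    then show ?case using elim(2) stable[OF step.hyps(1)] by simp
  qed
qed simp

lemma EG_stable:
  assumes "n \<ge> 2" "n \<le> m" and stable: "\<And>m g i. n \<le> m \<Longrightarrow> f (attach g m i) = f g"
  shows "EG m f = EG n f"
  unfolding EG_def using assms(1,2) AE_stable[OF assms]
  by (intro integral_cong_AE borel_measurable_G) auto

section \<open>Bounds on expectations along the process\<close>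

text \<open>Each step adds p (1 - p) <= 1. The constant 7 covers the start: at n = 2 the deviation
  is 2 p - 3, with square at most 9.\<close>

lemma EG_weight_variance:
  "n \<ge> 2 \<Longrightarrow> EG n (\<lambda>g. (weight n g - (2 - p) * real n)\<^sup>2) \<le> real n + 7"
proof (induction n rule: nat_induct_at_least)
  case base
  have "weight 2 ({0, 1}, {{0, 1}}) = 1"
    using weight_bounds[of 2 "({0, 1}, {{0, 1}})"] by (simp add: reachable_2)
  moreover have "(1 - (2 - p) * 2)\<^sup>2 \<le> 3\<^sup>2"
    using p_pos p_less_1 by (intro power2_le_iff_abs_le[THEN iffD2]) auto
  ultimately show ?case by (simp add: EG_2)
next
  case (Suc n)
  have "EG (Suc n) (\<lambda>g. (weight (Suc n) g - (2 - p) * real (Suc n))\<^sup>2) =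
      EG n (\<lambda>g. (weight n g - (2 - p) * real n)\<^sup>2 + p * (1 - p))"
    unfolding EG_Suc[OF Suc.hyps] by (intro EG_cong Suc.hyps step_weight_variance)
  also have "\<dots> = EG n (\<lambda>g. (weight n g - (2 - p) * real n)\<^sup>2) + p * (1 - p)"
    using Suc.hyps by (simp add: EG_add EG_const)
  also have "p * (1 - p) \<le> 1 * 1" using p_pos p_less_1 by (intro mult_mono) auto
  finally show ?case using Suc.IH by simp
qed

text \<open>The newborn term is at most 6 k! / ((n + 1) (n + 2)), a telescoping difference; the
  subtracted term carries it through the induction. At n = 2 the bound equals k!, the moment of the
  single edge.\<close>

lemma EG_moment:
  assumes k: "real k * (1 - p) \<ge> 4"
  shows "n \<ge> 2 \<Longrightarrow> EG n (moment p k n) \<le> 3 * fact k - 6 * fact k / (real n + 1)"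
proof (induction n rule: nat_induct_at_least)
  case base
  show ?case by (simp add: EG_2 moment_def growth_2 pochhammer_fact[symmetric] deg_at_edge[unfolded One_nat_def])
next
  case (Suc n)
  have "EG (Suc n) (moment p k (Suc n)) \<le> EG n (\<lambda>g. moment p k n g + 6 * fact k / ((real n + 1) * (real n + 2)))"
    unfolding EG_Suc[OF Suc.hyps]
  proof (rule EG_mono[OF Suc.hyps])
    fix g assume g: "g \<in> reachable n"
    have "real (Suc n) * (real (Suc n) + 1) / 6 \<le> growth p (real k) (Suc n) g"
      using Suc.hyps by (intro growth_ge[OF p_pos p_less_1 k Suc.hyps g]) auto
    then have "fact k / growth p (real k) (Suc n) g \<le> fact k / (real (Suc n) * (real (Suc n) + 1) / 6)"
      by (intro frac_le) simp_all
    then show "step p n (moment p k (Suc n)) g \<le> moment p k n g + 6 * fact k / ((real n + 1) * (real n + 2))"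
      unfolding step_moment[OF p_pos p_less_1 Suc.hyps g] by (simp add: add_ac mult_ac)
  qed
  also have "\<dots> = EG n (moment p k n) + 6 * fact k / ((real n + 1) * (real n + 2))"
    using Suc.hyps by (simp add: EG_add EG_const)
  also have "6 * fact k / ((real n + 1) * (real n + 2)) = 6 * fact k / (real n + 1) - 6 * fact k / (real (Suc n) + 1)"
    by (simp add: divide_simps) (simp add: algebra_simps)
  finally show ?case using Suc.IH by simp
qed

lemma EG_scaled_max_square_bounded:
  obtains B where "\<And>n. n \<ge> 2 \<Longrightarrow> EG n (\<lambda>g. (scaled_max p n g)\<^sup>2) \<le> B"
proof -
  \<comment> \<open>\<open>4 / (1 - p)\<close> ensures quadratic growth of the normaliser, and 2
    allows passing from squares to \<open>k\<close>-th powers.\<close>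
  obtain k where k: "real k \<ge> max 2 (4 / (1 - p))" using real_arch_simple by blast
  then have k': "real k * (1 - p) \<ge> 4" "k \<ge> 2" using p_less_1 by (auto simp: field_simps)
  have "EG n (\<lambda>g. (scaled_max p n g)\<^sup>2) \<le> 1 + 3 * fact k" if n: "n \<ge> 2" for n
  proof -
    have "EG n (\<lambda>g. (scaled_max p n g)\<^sup>2) \<le> EG n (\<lambda>g. 1 + moment p k n g)"
      using n k' p_pos p_less_1 by (intro EG_mono scaled_max_square_le) auto
    also have "\<dots> = 1 + EG n (moment p k n)"
      using n by (simp add: EG_add EG_const)
    also have "\<dots> \<le> 1 + (3 * fact k - 6 * fact k / (real n + 1))"
      using EG_moment[OF k'(1) n] by simp
    also have "\<dots> \<le> 1 + 3 * fact k" by simp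
    finally show ?thesis .
  qed
  then show thesis using that by blast
qed

lemma EG_negmoment: "n \<ge> 2 \<Longrightarrow> EG n (negmoment p n) = 1"
proof (induction n rule: nat_induct_at_least)
  case base
  show ?case by (simp add: EG_2 negmoment_def growth_2 half_factorial_def deg_at_edge[unfolded One_nat_def])
next
  case (Suc n)
  then show ?case
    using EG_cong[OF Suc.hyps step_negmoment[OF p_pos p_less_1 Suc.hyps]] by (simp add: EG_Suc)
qed

section \<open>Convergence of the normalised maximum\<close>

text \<open>Since the value at time \<open>n\<close> is nonnegative and fixed from then on, the
  submartingale inequality makes the mixed moment nondecreasing in \<open>m\<close>; at m = n it is
  the square.\<close>

lemma EG_scaled_max_mult:
  assumes "n \<ge> 2" "n \<le> m"
  shows "EG n (\<lambda>g. (scaled_max p n g)\<^sup>2) \<le> EG m (\<lambda>g. scaled_max p n g * scaled_max p m g)"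
  using assms(2)
proof (induction m rule: dec_induct)
  case base
  show ?case by (simp add: power2_eq_square)
next
  case (step m)
  have m: "m \<ge> 2" using assms(1) step.hyps by simp
  have "EG m (\<lambda>g. scaled_max p n g * scaled_max p m g) \<le> EG (Suc m) (\<lambda>g. scaled_max p n g * scaled_max p (Suc m) g)"
    unfolding EG_Suc[OF m]
  proof (rule EG_mono[OF m])
    fix g assume g: "g \<in> reachable m"
    have "step p m (\<lambda>g. scaled_max p n g * scaled_max p (Suc m) g) g =
        step p m (\<lambda>g'. scaled_max p n g * scaled_max p (Suc m) g') g"
      using step.hyps by (intro step_cong) (simp add: scaled_max_attach)
    also have "\<dots> = scaled_max p n g * step p m (scaled_max p (Suc m)) g"
      by (rule step_cmult)
    finally show "scaled_max p n g * scaled_max p m g \<le> step p m (\<lambda>g. scaled_max p n g * scaled_max p (Suc m) g) g"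
      using step_scaled_max_ge[OF p_pos p_less_1 m g] scaled_max_nonneg[OF p_pos p_less_1 m g, of n] step.hyps
      by (simp add: mult_left_mono)
  qed
  then show ?case using step.IH by linarith
qed

lemma EG_scaled_max_diff:
  assumes "n \<ge> 2" "n \<le> m"
  shows "EG m (\<lambda>g. (scaled_max p m g - scaled_max p n g)\<^sup>2) \<le>
    EG m (\<lambda>g. (scaled_max p m g)\<^sup>2) - EG n (\<lambda>g. (scaled_max p n g)\<^sup>2)"
proof -
  have m: "m \<ge> 2" using assms by simp
  have "EG m (\<lambda>g. (scaled_max p m g - scaled_max p n g)\<^sup>2) =
      EG m (\<lambda>g. (scaled_max p m g)\<^sup>2 + ((- 2) * (scaled_max p n g * scaled_max p m g) + (scaled_max p n g)\<^sup>2))"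
    by (simp add: power2_eq_square algebra_simps)
  also have "\<dots> = EG m (\<lambda>g. (scaled_max p m g)\<^sup>2) +
      ((- 2) * EG m (\<lambda>g. scaled_max p n g * scaled_max p m g) + EG m (\<lambda>g. (scaled_max p n g)\<^sup>2))"
    by (simp only: EG_add[OF m] EG_cmult)
  also have "EG m (\<lambda>g. (scaled_max p n g)\<^sup>2) = EG n (\<lambda>g. (scaled_max p n g)\<^sup>2)"
    by (rule EG_stable[OF assms]) (simp add: scaled_max_attach)
  finally show ?thesis using EG_scaled_max_mult[OF assms] by linarith
qed

lemma prob_scaled_max_diff:
  assumes "n \<ge> 2" "n \<le> m" "e > 0"
  shows "prob {\<omega> \<in> space M. \<bar>scaled_max p m (G m \<omega>) - scaled_max p n (G n \<omega>)\<bar> > e} \<le>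
    (EG m (\<lambda>g. (scaled_max p m g)\<^sup>2) - EG n (\<lambda>g. (scaled_max p n g)\<^sup>2)) / e\<^sup>2"
proof -
  have m: "m \<ge> 2" using assms by simp
  have [measurable]: "(\<lambda>\<omega>. scaled_max p i (G j \<omega>)) \<in> borel_measurable M" if "j \<ge> 2" for i j
    using that by (intro borel_measurable_G) simp
  have "AE \<omega> in M. scaled_max p n (G m \<omega>) = scaled_max p n (G n \<omega>)"
    by (rule AE_stable[OF assms(1,2)]) (simp add: scaled_max_attach)
  then have "prob {\<omega> \<in> space M. \<bar>scaled_max p m (G m \<omega>) - scaled_max p n (G n \<omega>)\<bar> > e} \<le>
      prob {\<omega> \<in> space M. e\<^sup>2 \<le> (scaled_max p m (G m \<omega>) - scaled_max p n (G m \<omega>))\<^sup>2}"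
  proof (intro finite_measure_mono_AE)
    show "{\<omega> \<in> space M. e\<^sup>2 \<le> (scaled_max p m (G m \<omega>) - scaled_max p n (G m \<omega>))\<^sup>2} \<in> events"
      using m by measurable
  next
    assume "AE \<omega> in M. scaled_max p n (G m \<omega>) = scaled_max p n (G n \<omega>)"
    then show "AE \<omega> in M. \<omega> \<in> {\<omega> \<in> space M. \<bar>scaled_max p m (G m \<omega>) - scaled_max p n (G n \<omega>)\<bar> > e} \<longrightarrow>
       \<omega> \<in> {\<omega> \<in> space M. e\<^sup>2 \<le> (scaled_max p m (G m \<omega>) - scaled_max p n (G m \<omega>))\<^sup>2}"
    proof eventually_elim
      case (elim \<omega>)
      have "e\<^sup>2 \<le> x\<^sup>2" if "e < \<bar>x\<bar>" for x
        using that \<open>e > 0\<close> abs_le_square_iff[of e x] by linarith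
      then show ?case using elim by simp
    qed
  qed
  also have "\<dots> \<le> EG m (\<lambda>g. (scaled_max p m g - scaled_max p n g)\<^sup>2) / e\<^sup>2"
    by (rule markov_G[OF m, of "e\<^sup>2" "\<lambda>g. (scaled_max p m g - scaled_max p n g)\<^sup>2"]) (use \<open>e > 0\<close> in auto)
  also have "\<dots> \<le> (EG m (\<lambda>g. (scaled_max p m g)\<^sup>2) - EG n (\<lambda>g. (scaled_max p n g)\<^sup>2)) / e\<^sup>2"
    by (intro divide_right_mono EG_scaled_max_diff assms) auto
  finally show ?thesis .
qed

lemma scaled_max_converges:
  obtains Y where "Y \<in> borel_measurable M"
    "tendsto_in_probability M (\<lambda>n \<omega>. scaled_max p (n + 2) (G (n + 2) \<omega>)) Y"
proof -
  \<comment> \<open>The shift by 2 starts the sequence where the recursion does and avoids the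
    unconstrained \<open>G 0\<close>.\<close>
  let ?X = "\<lambda>n \<omega>. scaled_max p (n + 2) (G (n + 2) \<omega>)"
  define a where "a n = EG (n + 2) (\<lambda>g. (scaled_max p (n + 2) g)\<^sup>2)" for n
  have prob_le: "prob {\<omega> \<in> space M. \<bar>?X m \<omega> - ?X n \<omega>\<bar> > e} \<le> \<bar>a m - a n\<bar> / e\<^sup>2"
    if "n \<le> m" "e > 0" for m n e
  proof -
    have "prob {\<omega> \<in> space M. \<bar>?X m \<omega> - ?X n \<omega>\<bar> > e} \<le> (a m - a n) / e\<^sup>2"
      using prob_scaled_max_diff[of "n + 2" "m + 2" e] that by (simp add: a_def)
    also have "\<dots> \<le> \<bar>a m - a n\<bar> / e\<^sup>2" by (intro divide_right_mono) auto
    finally show ?thesis .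
  qed
  have "incseq a"
    unfolding incseq_def
  proof (intro allI impI)
    fix n m :: nat assume "n \<le> m"
    have "0 \<le> EG (m + 2) (\<lambda>g. (scaled_max p (m + 2) g - scaled_max p (n + 2) g)\<^sup>2)"
      using EG_mono[of "m + 2" "\<lambda>_. 0"] by (simp add: EG_const)
    then show "a n \<le> a m"
      using EG_scaled_max_diff[of "n + 2" "m + 2"] \<open>n \<le> m\<close> by (simp add: a_def)
  qed
  moreover obtain B where "\<And>n. a n \<le> B"
    using EG_scaled_max_square_bounded unfolding a_def by (metis le_add2)
  ultimately have "Cauchy a"
    by (meson LIMSEQ_imp_Cauchy incseq_convergent)
  show thesis
  proof (rule Cauchy_in_probability[of ?X])
    fix e :: real assume "e > 0"
    \<comment> \<open>The tolerance e * e^2 compensates for the division by e^2 in the Chebyshev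
      bound.\<close>
    then obtain N where N: "\<And>m n. m \<ge> N \<Longrightarrow> n \<ge> N \<Longrightarrow> \<bar>a m - a n\<bar> < e * e\<^sup>2"
      using \<open>Cauchy a\<close> by (force simp: Cauchy_def dist_real_def dest: spec[of _ "e * e\<^sup>2"])
    have le: "prob {\<omega> \<in> space M. \<bar>?X m \<omega> - ?X n \<omega>\<bar> > e} \<le> e" if "n \<le> m" "N \<le> n" for m n
    proof -
      have "\<bar>a m - a n\<bar> / e\<^sup>2 \<le> e"
        using N[of m n] that \<open>e > 0\<close> by (simp add: pos_divide_le_eq less_imp_le)
      then show ?thesis using prob_le[OF that(1) \<open>e > 0\<close>] by linarith
    qed
    have "prob {\<omega> \<in> space M. \<bar>?X m \<omega> - ?X n \<omega>\<bar> > e} \<le> e" if "N \<le> m" "N \<le> n" for m n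
      using le[of n m] le[of m n] that by (cases "n \<le> m") (simp_all add: abs_minus_commute)
    then show "\<exists>N. \<forall>m\<ge>N. \<forall>n\<ge>N. prob {\<omega> \<in> space M. \<bar>?X m \<omega> - ?X n \<omega>\<bar> > e} \<le> e" by blast
  next
    show "?X n \<in> borel_measurable M" for n by (rule borel_measurable_G) simp
  qed (rule that)
qed

text \<open>On this event \<open>negmoment\<close> is at least 1 / (2 sqrt \<delta>); its mean is 1,
  so Markov's inequality gives the bound, uniformly in \<open>n\<close>.\<close>

lemma prob_scaled_max_small:
  assumes n: "n \<ge> 2" and "\<delta> > 0"
  shows "prob {\<omega> \<in> space M. scaled_max p n (G n \<omega>) \<le> \<delta>} \<le> 2 * sqrt \<delta>"
proof -
  let ?c = "1 / (2 * sqrt \<delta>)"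
  have "prob {\<omega> \<in> space M. scaled_max p n (G n \<omega>) \<le> \<delta>} \<le> prob {\<omega> \<in> space M. ?c \<le> negmoment p n (G n \<omega>)}"
  proof (rule finite_measure_mono_AE)
    show "AE \<omega> in M. \<omega> \<in> {\<omega> \<in> space M. scaled_max p n (G n \<omega>) \<le> \<delta>} \<longrightarrow>
        \<omega> \<in> {\<omega> \<in> space M. ?c \<le> negmoment p n (G n \<omega>)}"
      using AE_reachable[OF n]
    proof eventually_elim
      case (elim \<omega>)
      let ?v = "negmoment p n (G n \<omega>)"
      have v: "0 \<le> ?v" "1 \<le> 4 * ?v\<^sup>2 * scaled_max p n (G n \<omega>)"
        using negmoment_nonneg[OF p_pos p_less_1 n elim] scaled_max_negmoment[OF p_pos p_less_1 n elim] by auto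
      show ?case
      proof (intro impI, clarsimp)
        assume "scaled_max p n (G n \<omega>) \<le> \<delta>"
        then have "1 \<le> 4 * ?v\<^sup>2 * \<delta>"
          using v(2) mult_left_mono[of "scaled_max p n (G n \<omega>)" \<delta> "4 * ?v\<^sup>2"] by simp
        then have "1\<^sup>2 \<le> (2 * ?v * sqrt \<delta>)\<^sup>2" using \<open>\<delta> > 0\<close> by (simp add: power_mult_distrib)
        then have "1 \<le> 2 * ?v * sqrt \<delta>" using v(1) \<open>\<delta> > 0\<close> by (intro power2_le_imp_le[of 1]) auto
        then show "1 / (2 * sqrt \<delta>) \<le> ?v" using \<open>\<delta> > 0\<close> by (simp add: pos_divide_le_eq mult_ac)
      qed
    qed
    have [measurable]: "(\<lambda>\<omega>. negmoment p n (G n \<omega>)) \<in> borel_measurable M"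
      using n by (intro borel_measurable_G) simp
    show "{\<omega> \<in> space M. ?c \<le> negmoment p n (G n \<omega>)} \<in> events" by measurable
  qed
  also have "\<dots> \<le> EG n (negmoment p n) / ?c"
    using \<open>\<delta> > 0\<close> by (intro markov_G n negmoment_nonneg p_pos p_less_1) auto
  finally show ?thesis using EG_negmoment[OF n] by simp
qed

text \<open>If Y <= 0, then either the maximum is at most \<delta> or it differs from Y by more than
  \<delta>. Letting n grow first and then \<delta> tend to 0 removes both.\<close>

lemma limit_positive:
  assumes [measurable]: "Y \<in> borel_measurable M"
    and lim: "tendsto_in_probability M (\<lambda>n \<omega>. scaled_max p (n + 2) (G (n + 2) \<omega>)) Y"
  shows "AE \<omega> in M. 0 < Y \<omega>"
proof -
  let ?X = "\<lambda>n \<omega>. scaled_max p (n + 2) (G (n + 2) \<omega>)"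
  have [measurable]: "?X n \<in> borel_measurable M" for n by (rule borel_measurable_G) simp
  have le_sqrt: "prob {\<omega> \<in> space M. Y \<omega> \<le> 0} \<le> 2 * sqrt \<delta>" if "\<delta> > 0" for \<delta>
  proof (rule LIMSEQ_le_const)
    show "(\<lambda>n. 2 * sqrt \<delta> + prob {\<omega> \<in> space M. \<bar>?X n \<omega> - Y \<omega>\<bar> > \<delta>}) \<longlonglongrightarrow> 2 * sqrt \<delta>"
      using tendsto_add[OF tendsto_const tendsto_in_probabilityD[OF lim that]] by simp
    have "prob {\<omega> \<in> space M. Y \<omega> \<le> 0} \<le> 2 * sqrt \<delta> + prob {\<omega> \<in> space M. \<bar>?X n \<omega> - Y \<omega>\<bar> > \<delta>}" for n
    proof -
      have "prob {\<omega> \<in> space M. Y \<omega> \<le> 0} \<le>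
          prob ({\<omega> \<in> space M. ?X n \<omega> \<le> \<delta>} \<union> {\<omega> \<in> space M. \<bar>?X n \<omega> - Y \<omega>\<bar> > \<delta>})"
      proof (rule finite_measure_mono)
        have "x \<le> \<delta> \<or> \<bar>x - y\<bar> > \<delta>" if "y \<le> 0" for x y using that by linarith
        then show "{\<omega> \<in> space M. Y \<omega> \<le> 0} \<subseteq> {\<omega> \<in> space M. ?X n \<omega> \<le> \<delta>} \<union> {\<omega> \<in> space M. \<bar>?X n \<omega> - Y \<omega>\<bar> > \<delta>}"
          by blast
      qed measurable
      also have "\<dots> \<le> prob {\<omega> \<in> space M. ?X n \<omega> \<le> \<delta>} + prob {\<omega> \<in> space M. \<bar>?X n \<omega> - Y \<omega>\<bar> > \<delta>}"
        by (intro measure_Un_le) measurable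
      also have "\<dots> \<le> 2 * sqrt \<delta> + prob {\<omega> \<in> space M. \<bar>?X n \<omega> - Y \<omega>\<bar> > \<delta>}"
        using prob_scaled_max_small[of "n + 2" \<delta>] that by simp
      finally show ?thesis .
    qed
    then show "\<exists>N. \<forall>n\<ge>N. prob {\<omega> \<in> space M. Y \<omega> \<le> 0} \<le> 2 * sqrt \<delta> + prob {\<omega> \<in> space M. \<bar>?X n \<omega> - Y \<omega>\<bar> > \<delta>}"
      by blast
  qed
  have "prob {\<omega> \<in> space M. Y \<omega> \<le> 0} \<le> e" if "e > 0" for e
    using that le_sqrt[of "(e / 2)\<^sup>2"] by simp
  then have "prob {\<omega> \<in> space M. Y \<omega> \<le> 0} \<le> 0"
    by (rule field_le_epsilon) simp
  then have "prob {\<omega> \<in> space M. Y \<omega> \<le> 0} = 0"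
    by (intro antisym measure_nonneg)
  then have "AE \<omega> in M. \<omega> \<notin> {\<omega> \<in> space M. Y \<omega> \<le> 0}"
    by (intro AE_not_in) (simp add: null_sets_def emeasure_eq_measure)
  then show ?thesis using AE_space by eventually_elim auto
qed

section \<open>Comparison of the growth product with a power of n\<close>

text \<open>With s = sqrt n, the inequality A <= A^2 / s + s trades the first absolute moment for
  the variance. For n >= 2 the variance bound n + 7 is at most 5 s^2, and 5 <= 5 s, whence 11 = 5 +
  1 + 5. The resulting exponent -3/2 is summable.\<close>

lemma expectation_weight_deviation:
  assumes n: "n \<ge> 2"
  shows "EG n (\<lambda>g. \<bar>weight n g - (2 - p) * real n\<bar> / (real n)\<^sup>2 + 5 / (real n)\<^sup>2) \<le> 11 * real n powr (- 3 / 2)"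
proof -
  let ?s = "sqrt (real n)"
  have s: "?s > 0" "?s \<ge> 1" "?s\<^sup>2 = real n" using n by auto
  have alg: "1 / (s * c) * (5 * s\<^sup>2) + (s + 5 * s) / c = 11 * (s / c)" if "s > 0" "c > 0" for s c :: real
    using that by (simp add: field_simps power2_eq_square)
  have "EG n (\<lambda>g. \<bar>weight n g - (2 - p) * real n\<bar> / (real n)\<^sup>2 + 5 / (real n)\<^sup>2) \<le>
      EG n (\<lambda>g. 1 / (?s * (real n)\<^sup>2) * (weight n g - (2 - p) * real n)\<^sup>2 + (?s + 5) / (real n)\<^sup>2)"
  proof (rule EG_mono[OF n])
    fix g
    define A where "A = \<bar>weight n g - (2 - p) * real n\<bar>"
    have "A \<ge> 0" by (simp add: A_def)
    have "A \<le> A\<^sup>2 / ?s + ?s"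
    proof (cases "A \<le> ?s")
      case False
      then have "A * ?s \<le> A * A" using \<open>A \<ge> 0\<close> by (intro mult_left_mono) auto
      then have "A \<le> A\<^sup>2 / ?s" using s by (simp add: pos_le_divide_eq power2_eq_square)
      then show ?thesis using s(1) by linarith
    next
      case True
      then show ?thesis using s(1) zero_le_power2[of A] divide_nonneg_pos[of "A\<^sup>2" ?s] by linarith
    qed
    then have "A / (real n)\<^sup>2 \<le> (A\<^sup>2 / ?s + ?s) / (real n)\<^sup>2"
      by (rule divide_right_mono) simp
    then show "\<bar>weight n g - (2 - p) * real n\<bar> / (real n)\<^sup>2 + 5 / (real n)\<^sup>2 \<le>
        1 / (?s * (real n)\<^sup>2) * (weight n g - (2 - p) * real n)\<^sup>2 + (?s + 5) / (real n)\<^sup>2"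
      by (simp add: A_def add_divide_distrib)
  qed
  also have "\<dots> = 1 / (?s * (real n)\<^sup>2) * EG n (\<lambda>g. (weight n g - (2 - p) * real n)\<^sup>2) + (?s + 5) / (real n)\<^sup>2"
    by (simp only: EG_add[OF n] EG_cmult EG_const)
  also have "\<dots> \<le> 1 / (?s * (real n)\<^sup>2) * (5 * ?s\<^sup>2) + (?s + 5 * ?s) / (real n)\<^sup>2"
    using EG_weight_variance[OF n] n s by (intro add_mono mult_left_mono divide_right_mono) auto
  also have "\<dots> = 11 * (?s / (real n)\<^sup>2)"
    using n by (intro alg) auto
  also have "?s / (real n)\<^sup>2 = real n powr (- 3 / 2)"
    using n powr_diff[of "real n" "1 / 2" 2] by (simp add: powr_half_sqrt)
  finally show ?thesis .
qed

lemma growth_converges: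
  "AE \<omega> in M. convergent (\<lambda>n. ln (growth p 1 (n + 2) (G (n + 2) \<omega>)) - (1 - p) / (2 - p) * ln (real (n + 2)))"
proof -
  let ?b = "\<lambda>n \<omega>. \<bar>weight (n + 2) (G (n + 2) \<omega>) - (2 - p) * real (n + 2)\<bar> / (real (n + 2))\<^sup>2 + 5 / (real (n + 2))\<^sup>2"
  have "AE \<omega> in M. summable (\<lambda>n. ?b n \<omega>)"
  proof (rule AE_summable)
    show "integrable M (?b n)" for n
      by (rule integrable_G[of "n + 2" "\<lambda>g. \<bar>weight (n + 2) g - (2 - p) * real (n + 2)\<bar> / (real (n + 2))\<^sup>2 + 5 / (real (n + 2))\<^sup>2"]) simp
    show "summable (\<lambda>n. expectation (?b n))"
    proof (rule summable_comparison_test')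
      have "summable (\<lambda>n. real n powr (- 3 / 2))" by (simp add: summable_real_powr_iff)
      then have "summable (\<lambda>n. real (n + 2) powr (- 3 / 2))" by (rule summable_ignore_initial_segment)
      then show "summable (\<lambda>n. 11 * real (n + 2) powr (- 3 / 2))" by (rule summable_mult)
      show "norm (expectation (?b n)) \<le> 11 * real (n + 2) powr (- 3 / 2)" for n
      proof -
        have "0 \<le> expectation (?b n)" by (intro integral_nonneg_AE AE_I2) simp
        then show ?thesis using expectation_weight_deviation[of "n + 2"] by (simp add: EG_def)
      qed
    qed
  qed simp
  \<comment> \<open>One null set for all times, so that consecutive trees are linked by attachments
    along the whole path.\<close>
  moreover have "AE \<omega> in M. \<forall>n. G (n + 2) \<omega> \<in> reachable (n + 2) \<and>
      (\<exists>i<n + 2. G (Suc (n + 2)) \<omega> = attach (G (n + 2) \<omega>) (n + 2) i)"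
    unfolding AE_all_countable by (intro allI AE_attach) simp
  ultimately show ?thesis
  proof eventually_elim
    case (elim \<omega>)
    let ?L = "\<lambda>n. ln (growth p 1 (n + 2) (G (n + 2) \<omega>)) - (1 - p) / (2 - p) * ln (real (n + 2))"
    have "norm (?L (Suc n) - ?L n) \<le> ?b n \<omega>" for n
    proof -
      define N where "N = n + 2"
      define g where "g = G N \<omega>"
      obtain i where i: "G (Suc N) \<omega> = attach g N i" and g: "g \<in> reachable N"
        using elim(2) by (auto simp: N_def g_def)
      have N: "N \<ge> 2" by (simp add: N_def)
      have w: "weight N g \<ge> real N - 1" using weight_bounds[OF N g] by simp
      have "growth p 1 (Suc N) (G (Suc N) \<omega>) = growth p 1 N g * (1 + (1 - p) / weight N g)"
        by (simp add: i growth_attach growth_Suc[OF N] weight_attach_old)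
      moreover have "growth p 1 N g > 0" using growth_pos[OF p_pos p_less_1 _ N g, of 1 N] by simp
      moreover have "1 + (1 - p) / weight N g > 0" using w N p_less_1 by (intro add_pos_nonneg) auto
      ultimately have "ln (growth p 1 (Suc N) (G (Suc N) \<omega>)) = ln (growth p 1 N g) + ln (1 + (1 - p) / weight N g)"
        by (simp add: ln_mult)
      then have "?L (Suc n) - ?L n = ln (1 + (1 - p) / weight N g) - (1 - p) / (2 - p) * (ln (real N + 1) - ln (real N))"
        by (simp add: N_def g_def algebra_simps)
      then show ?thesis
        using ln_growth_factor_bound[OF p_pos p_less_1, of "real N" "weight N g"] N w
        by (simp add: N_def g_def)
    qed
    then have "summable (\<lambda>n. ?L (Suc n) - ?L n)"
      by (rule summable_comparison_test'[OF elim(1), of 0])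
    then show ?case by (rule convergent_if_summable_increments[where f = ?L])
  qed
qed

end

theorem theorem2p4:
  fixes M :: "'a measure" and p \<gamma> :: real and G :: "nat \<Rightarrow> 'a \<Rightarrow> graph"
    and \<Upsilon> :: "nat \<Rightarrow> 'a \<Rightarrow> nat"
  assumes "0 < p" and "p < 1"
    and "superstar_model M p G"
    and "\<And>n \<omega>. n \<ge> 2 \<Longrightarrow> \<Upsilon> n \<omega> = max_nonsuperstar_degree n (G n \<omega>)"
    and "\<gamma> = (1 - p) / (2 - p)"
  shows "\<exists>\<Delta> :: 'a \<Rightarrow> real.
           \<Delta> \<in> borel_measurable M \<and>
           measure M {\<omega> \<in> space M. 0 < \<Delta> \<omega>} = 1 \<and>
           tendsto_in_probability M (\<lambda>n \<omega>. 1 / real n powr \<gamma> * real (\<Upsilon> n \<omega>)) \<Delta>"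
proof -
  interpret superstar_model M p G by fact
  interpret superstar M p G by unfold_locales fact+
  obtain Y where [measurable]: "Y \<in> borel_measurable M"
    and Y: "tendsto_in_probability M (\<lambda>n \<omega>. scaled_max p (n + 2) (G (n + 2) \<omega>)) Y"
    using scaled_max_converges .
  \<comment> \<open>Its exponential is the growth product divided by n^gamma. The almost sure limit
    is finite, so the exponential of the limit is strictly positive.\<close>
  let ?L = "\<lambda>n \<omega>. ln (growth p 1 (n + 2) (G (n + 2) \<omega>)) - \<gamma> * ln (real (n + 2))"
  have [measurable]: "?L n \<in> borel_measurable M" for n
    by (rule borel_measurable_G[where f = "\<lambda>g. ln (growth p 1 (n + 2) g) - \<gamma> * ln (real (n + 2))"]) simp
  have X_meas: "(\<lambda>\<omega>. scaled_max p (n + 2) (G (n + 2) \<omega>)) \<in> borel_measurable M" for n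
    by (rule borel_measurable_G) simp
  define L where "L \<omega> = lim (\<lambda>n. ?L n \<omega>)" for \<omega>
  have [measurable]: "L \<in> borel_measurable M" unfolding L_def by measurable
  have "AE \<omega> in M. (\<lambda>n. exp (?L n \<omega>)) \<longlonglongrightarrow> exp (L \<omega>)"
    using growth_converges unfolding assms(5)[symmetric]
    by eventually_elim (auto intro!: tendsto_exp simp: convergent_LIMSEQ_iff L_def)
  then have "tendsto_in_probability M (\<lambda>n \<omega>. exp (?L n \<omega>)) (\<lambda>\<omega>. exp (L \<omega>))"
    by (intro tendsto_in_probability_AE) measurable
  then have lim: "tendsto_in_probability M
      (\<lambda>n \<omega>. scaled_max p (n + 2) (G (n + 2) \<omega>) * exp (?L n \<omega>)) (\<lambda>\<omega>. Y \<omega> * exp (L \<omega>))"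
    using Y X_meas by (intro tendsto_in_probability_mult) measurable
  \<comment> \<open>The random growth product cancels, leaving the maximal degree over n^gamma. This
    needs a reachable tree, where the product is positive and \<open>deg_at\<close> is the true
    degree, hence only almost sure equality.\<close>
  have eq: "AE \<omega> in M. scaled_max p (n + 2) (G (n + 2) \<omega>) * exp (?L n \<omega>) =
      1 / real (n + 2) powr \<gamma> * real (\<Upsilon> (n + 2) \<omega>)" for n
    using AE_reachable[of "n + 2", simplified]
  proof eventually_elim
    case (elim \<omega>)
    have n: "2 \<le> n + 2" by simp
    have g: "G (n + 2) \<omega> \<in> reachable (n + 2)" using elim by simp
    have "growth p 1 (n + 2) (G (n + 2) \<omega>) > 0"
      using growth_pos[OF assms(1,2) _ n g, of 1 "n + 2"] by simp
    moreover have "real (n + 2) > 0" by simp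
    ultimately have "exp (?L n \<omega>) = growth p 1 (n + 2) (G (n + 2) \<omega>) / real (n + 2) powr \<gamma>"
      unfolding exp_diff by (simp only: exp_ln powr_def) simp
    moreover have "scaled_max p (n + 2) (G (n + 2) \<omega>) = real (\<Upsilon> (n + 2) \<omega>) / growth p 1 (n + 2) (G (n + 2) \<omega>)"
      unfolding scaled_max_def deg_at_reachable[OF n g] assms(4)[OF n] max_nonsuperstar_degree_def ..
    ultimately show ?case using \<open>growth p 1 (n + 2) (G (n + 2) \<omega>) > 0\<close> by simp
  qed
  have \<Upsilon>_meas: "(\<lambda>\<omega>. 1 / real (n + 2) powr \<gamma> * real (\<Upsilon> (n + 2) \<omega>)) \<in> borel_measurable M" for n
    unfolding assms(4)[OF le_add2] by (rule borel_measurable_G) simp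
  have lim_meas: "(\<lambda>\<omega>. Y \<omega> * exp (L \<omega>)) \<in> borel_measurable M" by measurable
  have prod_meas: "(\<lambda>\<omega>. scaled_max p (n + 2) (G (n + 2) \<omega>) * exp (?L n \<omega>)) \<in> borel_measurable M" for n
    by (rule borel_measurable_G[where f = "\<lambda>g. scaled_max p (n + 2) g * exp (ln (growth p 1 (n + 2) g) - \<gamma> * ln (real (n + 2)))"]) simp
  have "tendsto_in_probability M (\<lambda>n \<omega>. 1 / real (n + 2) powr \<gamma> * real (\<Upsilon> (n + 2) \<omega>)) (\<lambda>\<omega>. Y \<omega> * exp (L \<omega>))"
    by (rule tendsto_in_probability_AE_cong[OF prod_meas \<Upsilon>_meas lim_meas eq lim])
  then have "tendsto_in_probability M (\<lambda>n \<omega>. 1 / real n powr \<gamma> * real (\<Upsilon> n \<omega>)) (\<lambda>\<omega>. Y \<omega> * exp (L \<omega>))"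
    by (rule tendsto_in_probability_offset[where X = "\<lambda>n \<omega>. 1 / real n powr \<gamma> * real (\<Upsilon> n \<omega>)"])
  moreover have "AE \<omega> in M. 0 < Y \<omega> * exp (L \<omega>)"
    using limit_positive[OF \<open>Y \<in> borel_measurable M\<close> Y] by eventually_elim simp
  then have "prob {\<omega> \<in> space M. 0 < Y \<omega> * exp (L \<omega>)} = 1"
    by (intro prob_Collect_eq_1[THEN iffD2]) measurable
  ultimately show ?thesis
    by (intro exI[of _ "\<lambda>\<omega>. Y \<omega> * exp (L \<omega>)"] conjI lim_meas)
qed

end
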